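(* Let $\sigma\in\{0,1\}$ and $T>0$. Consider the solution $f_k(t,y)$ of $$\partial_t f_k+ikV(t,y)f_k=\nu\partial_y^2f_k-\sigma\nu|k|^2f_k,\qquad f_k(t=0,y)=f_{0;k}(y),\qquad y\in\mathbb{R},$$ initiated from initial data $f_0\in C_c^\infty(\mathbb{T}\times\mathbb{R})$. Assume that on the time interval $[0,T]$ the $C_tC_y^2$ velocity profile $V(t,y)$ satisfies $$\inf_{t\in[0,T],\,y\in\mathbb{R}}|\partial_yV(t,y)|\ge \mathfrak{c}>0,\qquad \|V\|_{L^\infty_t([0,T];W^{3,\infty}_y)}<C .$$ Then there exists a threshold $\nu_0=\nu_0(V)$ such that for $\nu<\nu_0$ the following estimate holds: $$\|f_k(t)\|_{L^2}\le e\,\|f_{0;k}\|_{L^2}\exp\left\{-\delta\,\nu^{1/3}|k|^{2/3}\,t\right\},\qquad \forall t\in[0,T].$$ Here $\delta>0$ is a constant depending only on $\mathfrak{c}$ and $\|V\|_{L^\infty_tC^3_y}$.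
   Context: $\mathbb{T}=[-\pi,\pi]$ is the torus, $\nu>0$, and $V$ is real-valued. $k\in\mathbb{Z}$ is the Fourier frequency in $x$, and $f_{0;k}(y)$ denotes the $k$-th Fourier coefficient of $f_0(\cdot,y)$ in the $x$ variable. The equation for $f_k$ is obtained by taking the Fourier transform in $x$ of the passive scalar equation $\partial_tf+V(t,y)\partial_xf=\nu(\sigma\partial_x^2+\partial_y^2)f$, $f(0,x,y)=f_0(x,y)$, on $\mathbb{T}\times\mathbb{R}$, where $(V(t,y),0)$ is a time-dependent shear flow. $L^2$ norms are taken in $y\in\mathbb{R}$. $\|g\|_{L^\infty_tW^{m,\infty}_y}$ is the essential supremum over $t$ of the $W^{m,\infty}$-norm in $y$. $C$ denotes a finite constant independent of $\nu$ and $k$.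
   Formalization: Since |∂_yV| ≥ c > 0 on all of R makes V unbounded, its full W^{3,∞} norm is infinite; the norm of V (in the hypothesis and in the dependence of δ) is taken as that of its y-derivatives of order 1 to 3, without the order-0 term. *)

theory Defs
  imports "HOL-Analysis.Analysis" "HOL-Probability.Essential_Supremum"
begin

primrec Ck :: "nat \<Rightarrow> ('a::real_normed_vector \<Rightarrow> 'b::real_normed_vector) \<Rightarrow> bool" where
  "Ck 0 f \<longleftrightarrow> continuous_on UNIV f"
| "Ck (Suc n) f \<longleftrightarrow> (\<forall>x. f differentiable (at x)) \<and>
      (\<forall>v. Ck n (\<lambda>x. frechet_derivative f (at x) v))"

definition smooth :: "('a::real_normed_vector \<Rightarrow> 'b::real_normed_vector) \<Rightarrow> bool" where
  "smooth f \<longleftrightarrow> (\<forall>n. Ck n f)"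

text \<open>Functions on the cylinder (torus times line) are functions on the plane that are
  \<open>2\<pi>\<close>-periodic in the first variable; only the second variable has to be cut off for
  compact support.\<close>

definition Cc_smooth_cylinder :: "(real \<times> real \<Rightarrow> complex) \<Rightarrow> bool" where
  "Cc_smooth_cylinder f0 \<longleftrightarrow> smooth f0 \<and> (\<forall>x y. f0 (x + 2 * pi, y) = f0 (x, y)) \<and>
     (\<exists>R. \<forall>x y. R < \<bar>y\<bar> \<longrightarrow> f0 (x, y) = 0)"

definition fourier_coeff_x :: "int \<Rightarrow> (real \<times> real \<Rightarrow> complex) \<Rightarrow> real \<Rightarrow> complex" where
  "fourier_coeff_x k f0 y =
     of_real (1 / (2 * pi)) * integral {-pi..pi} (\<lambda>x. f0 (x, y) * cis (- (of_int k * x)))"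

definition square_integrable :: "(real \<Rightarrow> complex) \<Rightarrow> bool" where
  "square_integrable g \<longleftrightarrow>
     g \<in> borel_measurable lborel \<and> integrable lborel (\<lambda>y. (cmod (g y))\<^sup>2)"

text \<open>Only meaningful for square integrable functions (the integral defaults to 0).\<close>

definition L2_norm :: "(real \<Rightarrow> complex) \<Rightarrow> real" where
  "L2_norm g = sqrt (\<integral>y. (cmod (g y))\<^sup>2 \<partial>lborel)"

definition test_function :: "(real \<Rightarrow> real) \<Rightarrow> bool" where
  "test_function \<phi> \<longleftrightarrow> smooth \<phi> \<and> (\<exists>R. \<forall>y. R < \<bar>y\<bar> \<longrightarrow> \<phi> y = 0)"

definition locally_integrable :: "(real \<Rightarrow> real) \<Rightarrow> bool" where
  "locally_integrable u \<longleftrightarrow> (\<forall>R. set_integrable lborel {-R..R} u)"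

definition weak_deriv :: "nat \<Rightarrow> (real \<Rightarrow> real) \<Rightarrow> (real \<Rightarrow> real) \<Rightarrow> bool" where
  "weak_deriv j u g \<longleftrightarrow> locally_integrable u \<and> locally_integrable g \<and>
     (\<forall>\<phi>. test_function \<phi> \<longrightarrow>
        (\<integral>y. u y * (deriv ^^ j) \<phi> y \<partial>lborel) = (-1) ^ j * (\<integral>y. g y * \<phi> y \<partial>lborel))"

definition Linf_norm :: "(real \<Rightarrow> real) \<Rightarrow> ereal" where
  "Linf_norm g = esssup lborel (\<lambda>y. ereal \<bar>g y\<bar>)"

text \<open>The norm of \<open>W\<^sup>m\<^sup>,\<^sup>\<infinity>(\<real>)\<close>. Weak derivatives are unique up to null sets, so all families
  \<open>g\<close> in the infimum give the same value; if there is none, the norm is \<open>\<infinity>\<close>.\<close>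

definition Wminf_norm :: "nat \<Rightarrow> (real \<Rightarrow> real) \<Rightarrow> ereal" where
  "Wminf_norm m u =
     (INF g \<in> {g. g 0 = u \<and> (\<forall>j\<le>m. weak_deriv j u (g j))}. \<Sum>j\<le>m. Linf_norm (g j))"

definition Linf_t_Wminf_norm :: "real \<Rightarrow> nat \<Rightarrow> (real \<Rightarrow> real \<Rightarrow> real) \<Rightarrow> ereal" where
  "Linf_t_Wminf_norm T m g = esssup (restrict_space lborel {0..T}) (\<lambda>t. Wminf_norm m (g t))"

text \<open>A velocity profile with \<open>\<bar>\<partial>\<^sub>yV\<bar> \<ge> \<cc> > 0\<close> on the whole line is unbounded, so its full
  \<open>W\<^sup>3\<^sup>,\<^sup>\<infinity>\<close> norm is infinite. The \<open>L\<^sup>\<infinity>\<^sub>t W\<^sup>3\<^sup>,\<^sup>\<infinity>\<^sub>y\<close> size of \<open>V\<close> is therefore understood as that of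
  its derivatives of order 1, 2, 3, without the order-0 term.\<close>

definition shear_norm :: "real \<Rightarrow> (real \<Rightarrow> real \<Rightarrow> real) \<Rightarrow> ereal" where
  "shear_norm T V = Linf_t_Wminf_norm T 2 (\<lambda>t. deriv (V t))"

text \<open>For the same reason, continuity in time with values in \<open>C\<^sup>2\<close> refers to locally uniform
  convergence in \<open>y\<close>, that is, to joint continuity of \<open>V, \<partial>\<^sub>yV, \<partial>\<^sub>y\<^sup>2V\<close>.\<close>

definition Ct_C2y :: "real \<Rightarrow> (real \<Rightarrow> real \<Rightarrow> real) \<Rightarrow> bool" where
  "Ct_C2y T V \<longleftrightarrow>
     (\<forall>t\<in>{0..T}. \<forall>y. V t field_differentiable at y \<and> deriv (V t) field_differentiable at y) \<and>
     (\<forall>j\<le>2. continuous_on ({0..T} \<times> UNIV) (\<lambda>(t, y). (deriv ^^ j) (V t) y))"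

text \<open>Classical solutions, attaining the initial datum continuously, whose \<open>L\<^sup>2\<close> norm is bounded
  on \<open>[0,T]\<close>. On the unbounded line the last condition makes the solution unique.\<close>

definition mode_solution ::
  "real \<Rightarrow> real \<Rightarrow> real \<Rightarrow> int \<Rightarrow> (real \<Rightarrow> real \<Rightarrow> real) \<Rightarrow> (real \<Rightarrow> complex) \<Rightarrow>
     (real \<Rightarrow> real \<Rightarrow> complex) \<Rightarrow> bool" where
  "mode_solution T \<nu> \<sigma> k V g f \<longleftrightarrow>
     continuous_on ({0..T} \<times> UNIV) (\<lambda>(t, y). f t y) \<and>
     (\<forall>y. f 0 y = g y) \<and>
     (\<exists>B. \<forall>t\<in>{0..T}. square_integrable (f t) \<and> L2_norm (f t) \<le> B) \<and>
     (\<exists>ft fy fyy.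
        continuous_on ({0<..T} \<times> UNIV) (\<lambda>(t, y). ft t y) \<and>
        continuous_on ({0<..T} \<times> UNIV) (\<lambda>(t, y). fy t y) \<and>
        continuous_on ({0<..T} \<times> UNIV) (\<lambda>(t, y). fyy t y) \<and>
        (\<forall>t\<in>{0<..T}. \<forall>y.
           ((\<lambda>s. f s y) has_vector_derivative ft t y) (at t within {0..T}) \<and>
           (f t has_vector_derivative fy t y) (at y) \<and>
           (fy t has_vector_derivative fyy t y) (at y) \<and>
           ft t y + \<i> * of_int k * of_real (V t y) * f t y =
             of_real \<nu> * fyy t y - of_real (\<sigma> * \<nu> * (of_int \<bar>k\<bar>)\<^sup>2) * f t y))"

end

theory Submission
  imports Defs
begin

text \<open>
  Let \<open>\<sigma> = 0\<close> and let \<open>F\<close> be the solution. The cross term \<open>Q = Im \<integral> F(y+h) cnj (F y) dy\<close> satisfies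
  \<open>Q' = -k Re \<integral> (V(y+h) - V(y)) F(y+h) cnj (F y) - 2\<nu> Im \<integral> F\<^sub>y(y+h) cnj (F\<^sub>y y)\<close>. Since \<open>\<partial>\<^sub>yV\<close> has a
  constant sign and \<open>c \<le> \<bar>\<partial>\<^sub>yV\<bar> \<le> M\<close>, up to a sign the first integral is at least
  \<open>c h \<bar>k\<bar> \<parallel>F\<parallel>\<^sup>2 / 2\<close> minus \<open>M h\<^sup>3 \<bar>k\<bar> \<parallel>F\<^sub>y\<parallel>\<^sup>2 / 2\<close>, and for \<open>h = (\<nu>/\<bar>k\<bar>)\<^sup>1\<^sup>/\<^sup>3\<close> all gradient terms are bounded by
  a multiple of \<open>\<nu> \<parallel>F\<^sub>y\<parallel>\<^sup>2\<close>, the dissipation in the energy identity. As \<open>\<bar>Q\<bar> \<le> \<parallel>F\<parallel>\<^sup>2\<close>,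
  integration over a time window of length \<open>\<tau> = A \<nu>\<^sup>-\<^sup>1\<^sup>/\<^sup>3 \<bar>k\<bar>\<^sup>-\<^sup>2\<^sup>/\<^sup>3\<close> shows that the \<open>L\<^sup>2\<close> norm drops by a
  factor \<open>e\<close>. The finite difference in place of \<open>\<partial>\<^sub>yF\<close> avoids second derivatives in the estimates.
  Solutions carry no decay of \<open>F\<^sub>y\<close>
  at infinity; every identity is localised with a cutoff \<open>\<chi>\<close>, and writing the diffusion as
  \<open>\<integral> \<chi>'' \<bar>F\<bar>\<^sup>2 - 2 \<integral> \<chi> \<bar>F\<^sub>y\<bar>\<^sup>2\<close> makes the cutoff error depend on the \<open>L\<^sup>2\<close> bound only.
\<close>

subsection \<open>Bounds on the shear\<close>

lemma continuous_on_slice: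
  assumes "continuous_on (A \<times> UNIV) (\<lambda>(t, y). f t y)"
  shows continuous_on_slice_snd: "t \<in> A \<Longrightarrow> continuous_on X (f t)"
    and continuous_on_slice_fst: "continuous_on A (\<lambda>t. f t y)"
proof -
  show "continuous_on X (f t)" if "t \<in> A"
    using continuous_on_compose2[OF assms, of X "Pair t"] that
    by (force intro: continuous_intros)
  show "continuous_on A (\<lambda>t. f t y)"
    using continuous_on_compose2[OF assms, of A "\<lambda>t. (t, y)"]
    by (force intro: continuous_intros)
qed

text \<open>Over a null measure the essential supremum of a measurable function is minus infinity.
  Lebesgue measure is nonzero, so some point witnesses the almost-everywhere bound.\<close>

lemma Linf_norm_nonneg: "0 \<le> Linf_norm g"
proof -
  have "ae_filter (lborel :: real measure) \<noteq> bot"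
    by (simp add: ae_filter_eq_bot_iff)
  moreover have "AE y in lborel. ereal \<bar>g y\<bar> \<le> Linf_norm g"
    unfolding Linf_norm_def by (rule esssup_AE)
  ultimately obtain y where "ereal \<bar>g y\<bar> \<le> Linf_norm g"
    using eventually_happens' by blast
  then show ?thesis by (rule order_trans[rotated]) simp
qed

lemma Linf_norm_le_Wminf_norm: "Linf_norm u \<le> Wminf_norm m u"
  unfolding Wminf_norm_def
proof (rule INF_greatest)
  fix g :: "nat \<Rightarrow> real \<Rightarrow> real"
  assume "g \<in> {g. g 0 = u \<and> (\<forall>j\<le>m. weak_deriv j u (g j))}"
  then have "Linf_norm u = (\<Sum>j\<in>{0}. Linf_norm (g j))"
    by simp
  also have "\<dots> \<le> (\<Sum>j\<le>m. Linf_norm (g j))"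
    by (rule sum_mono2) (auto intro: Linf_norm_nonneg)
  finally show "Linf_norm u \<le> (\<Sum>j\<le>m. Linf_norm (g j))" .
qed

text \<open>For continuous \<open>g\<close> the sublevel set is closed, and a closed set of full
  measure is the whole line.\<close>

lemma abs_le_Linf_norm:
  assumes "continuous_on UNIV g" "Linf_norm g \<le> ereal M"
  shows "\<bar>g y\<bar> \<le> M"
proof -
  have "AE y in lborel. \<bar>g y\<bar> \<le> M"
  proof (rule eventually_mono)
    show "AE y in lborel. ereal \<bar>g y\<bar> \<le> Linf_norm g"
      unfolding Linf_norm_def by (rule esssup_AE)
    show "\<bar>g y\<bar> \<le> M" if "ereal \<bar>g y\<bar> \<le> Linf_norm g" for y
      using order_trans[OF that assms(2)] by simp
  qed
  then have "AE y in lebesgue. y \<in> {y. \<bar>g y\<bar> \<le> M}"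
    by (simp add: AE_completion)
  moreover have "closed {y. \<bar>g y\<bar> \<le> M}"
    using assms(1) by (intro closed_Collect_le continuous_intros)
  ultimately show ?thesis
    using mem_closed_if_AE_lebesgue by blast
qed

lemma Ct_C2y_continuous_deriv:
  assumes "Ct_C2y T V"
  shows "continuous_on ({0..T} \<times> UNIV) (\<lambda>(t, y). deriv (V t) y)"
proof -
  have "\<forall>j\<le>2. continuous_on ({0..T} \<times> UNIV) (\<lambda>(t, y). (deriv ^^ j) (V t) y)"
    using assms unfolding Ct_C2y_def by blast
  from this[rule_format, of 1] show ?thesis by simp
qed

text \<open>The essential bound becomes pointwise by joint continuity of the shear: first in
  \<open>y\<close> for almost every \<open>t\<close>, then in \<open>t\<close> for fixed
  \<open>y\<close>.\<close>

lemma abs_deriv_le_shear_norm: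
  assumes T: "0 < T" and V: "Ct_C2y T V" and C: "shear_norm T V < ereal C" and t: "t \<in> {0..T}"
  shows "\<bar>deriv (V t) y\<bar> \<le> real_of_ereal (shear_norm T V)"
proof -
  define M where "M = real_of_ereal (shear_norm T V)"
  let ?I = "restrict_space lborel {0..T}"
  note cont = Ct_C2y_continuous_deriv[OF V]
  have ae: "AE t in ?I. Wminf_norm 2 (deriv (V t)) \<le> shear_norm T V"
    unfolding shear_norm_def Linf_t_Wminf_norm_def by (rule esssup_AE)
  have "emeasure ?I (space ?I) = ennreal T"
    using T by (simp add: emeasure_restrict_space space_restrict_space)
  then have "ae_filter ?I \<noteq> bot"
    using T by (simp add: ae_filter_eq_bot_iff)
  then obtain s where "Wminf_norm 2 (deriv (V s)) \<le> shear_norm T V"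
    using ae eventually_happens' by blast
  \<comment> \<open>This excludes minus infinity, where \<open>real_of_ereal\<close> returns the
    default 0 and \<open>M\<close> would not represent the norm.\<close>
  then have "0 \<le> shear_norm T V"
    by (meson Linf_norm_nonneg Linf_norm_le_Wminf_norm order_trans)
  then have M: "shear_norm T V = ereal M"
    using C unfolding M_def by (cases "shear_norm T V") auto
  have "AE t in lborel. t \<in> {0..T} \<longrightarrow> Wminf_norm 2 (deriv (V t)) \<le> ereal M"
    using ae by (subst (asm) AE_restrict_space_iff) (auto simp: M)
  then have "AE t in lborel. t \<in> {0<..<T} \<longrightarrow> t \<in> {t \<in> {0..T}. \<bar>deriv (V t) y\<bar> \<le> M}"
  proof eventually_elim
    case (elim t)
    show ?case
    proof
      assume "t \<in> {0<..<T}"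
      then have t: "t \<in> {0..T}" by simp
      have "continuous_on UNIV (\<lambda>y. deriv (V t) y)"
        using t by (rule continuous_on_slice_snd[OF cont])
      moreover have "Linf_norm (deriv (V t)) \<le> ereal M"
        using elim t by (auto intro: order_trans[OF Linf_norm_le_Wminf_norm])
      ultimately show "t \<in> {t \<in> {0..T}. \<bar>deriv (V t) y\<bar> \<le> M}"
        using t by (auto intro: abs_le_Linf_norm)
    qed
  qed
  then have ae': "AE t \<in> {0<..<T} in lebesgue. t \<in> {t \<in> {0..T}. \<bar>deriv (V t) y\<bar> \<le> M}"
    by (simp add: AE_completion)
  have "continuous_on {0..T} (\<lambda>t. \<bar>deriv (V t) y\<bar>)"
    by (rule continuous_on_rabs[OF continuous_on_slice_fst[OF cont]])
  then have cl: "closed {t \<in> {0..T}. \<bar>deriv (V t) y\<bar> \<le> M}"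
    by (rule continuous_on_closed_Collect_le) auto
  have "{0<..<T} \<subseteq> {t \<in> {0..T}. \<bar>deriv (V t) y\<bar> \<le> M}"
    using mem_closed_if_AE_lebesgue_open[OF open_greaterThanLessThan cl ae'] by blast
  \<comment> \<open>Full measure gives the bound on the open interval; the two endpoints follow by
    closure.\<close>
  from closure_minimal[OF this cl] show ?thesis
    using t T unfolding M_def[symmetric] by auto
qed

text \<open>The image is connected and avoids 0. Applied to the shear on
  \<open>{0..T} \<times> UNIV\<close>, it yields one sign for all times and heights at once.\<close>

lemma constant_sign_if_bounded_away:
  fixes g :: "'a::topological_space \<Rightarrow> real"
  assumes S: "connected S" and g: "continuous_on S g" and c: "0 < c" "\<And>x. x \<in> S \<Longrightarrow> c \<le> \<bar>g x\<bar>"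
  obtains s where "s \<in> {1, -1}" "\<And>x. x \<in> S \<Longrightarrow> \<bar>g x\<bar> = s * g x"
proof (cases "\<exists>x\<in>S. g x < 0")
  case True
  then obtain x where x: "x \<in> S" "g x < 0" by blast
  have "g z < 0" if "z \<in> S" for z
  proof (rule ccontr)
    assume "\<not> g z < 0"
    moreover have "connected (g ` S)"
      using S g by (rule connected_continuous_image[rotated])
    ultimately have "0 \<in> g ` S"
      using x that by (intro connectedD_interval[of "g ` S" "g x" "g z" 0]) auto
    then show False using c by force
  qed
  then show ?thesis using that[of "-1"] by (simp add: abs_of_neg)
next
  case False
  then show ?thesis using that[of 1] by (auto simp: not_less)
qed

subsection \<open>Cutoff\<close>

text \<open>The cutoff is only ever integrated over \<open>[-R, R]\<close>; it vanishes to second order at \<open>\<plusminus>R\<close>, so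
  integrating by parts twice leaves no boundary terms.\<close>

definition bump :: "real \<Rightarrow> real \<Rightarrow> real" where
  "bump R y = (1 - (y / R)\<^sup>2)\<^sup>2"

definition bump' :: "real \<Rightarrow> real \<Rightarrow> real" where
  "bump' R y = - (4 * y / R\<^sup>2) * (1 - (y / R)\<^sup>2)"

definition bump'' :: "real \<Rightarrow> real \<Rightarrow> real" where
  "bump'' R y = (12 * (y / R)\<^sup>2 - 4) / R\<^sup>2"

lemma square_quotient_le_one:
  fixes y :: real
  assumes "y \<in> {-R..R}" "0 < R"
  shows "(y / R)\<^sup>2 \<le> 1"
proof -
  have "\<bar>y / R\<bar> \<le> 1"
    using assms by (simp add: abs_le_iff field_simps)
  then show ?thesis by (simp add: abs_square_le_1)
qed

lemma bump_nonneg: "0 \<le> bump R y"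
  by (simp add: bump_def)

lemma bump_le_one: "y \<in> {-R..R} \<Longrightarrow> 0 < R \<Longrightarrow> bump R y \<le> 1"
  using square_quotient_le_one[of y R] unfolding bump_def by (intro power_le_one) auto

text \<open>On the half-scale interval the cutoff is at least 9/16. This lets the dissipation at
  scale \<open>2 * R\<close> control the full gradient on \<open>{-R..R}\<close>.\<close>

lemma bump_ge_half:
  assumes "\<bar>y\<bar> \<le> R / 2" "0 < R"
  shows "1 / 2 \<le> bump R y"
proof -
  have "\<bar>y / R\<bar> \<le> 1 / 2"
    using assms by (simp add: field_simps)
  then have "(y / R)\<^sup>2 \<le> (1 / 2)\<^sup>2"
    by (metis abs_ge_zero power2_abs power_mono)
  then have "(3 / 4)\<^sup>2 \<le> bump R y"
    unfolding bump_def by (intro power_mono) (auto simp: power2_eq_square)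
  then show ?thesis by (simp add: power2_eq_square)
qed

text \<open>On [0,1] the function 12x - 4 takes values in [-4,8]. This factor
  \<open>8 / R\<^sup>2\<close> is the source of all cutoff errors, which vanish as \<open>R\<close>
  grows.\<close>

lemma abs_bump''_le:
  assumes "y \<in> {-R..R}" "0 < R"
  shows "\<bar>bump'' R y\<bar> \<le> 8 / R\<^sup>2"
proof -
  have "\<bar>12 * (y / R)\<^sup>2 - 4\<bar> \<le> 8"
    using square_quotient_le_one[OF assms] zero_le_power2[of "y / R"] by linarith
  then show ?thesis
    by (simp add: bump''_def abs_divide divide_right_mono)
qed

lemma continuous_on_bump [continuous_intros]:
  "continuous_on S (bump R)" "continuous_on S (bump'' R)"
  unfolding bump_def bump''_def divide_inverse by (intro continuous_intros)+

lemma bump_has_real_derivative: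
  assumes "0 < R"
  shows "(bump R has_real_derivative bump' R y) (at y within S)"
    and "(bump' R has_real_derivative bump'' R y) (at y within S)"
  unfolding bump_def[abs_def] bump'_def[abs_def] bump''_def using assms
  by (auto intro!: derivative_eq_intros simp: field_simps power2_eq_square)

text \<open>Both integrations by parts are done at once: the integrand has the antiderivative
  \<open>bump R y *\<^sub>R p' y - bump' R y *\<^sub>R p y\<close>, which is 0 at both ends.\<close>

lemma integral_bump_by_parts:
  fixes p p' p'' :: "real \<Rightarrow> complex"
  assumes R: "0 < R"
    and p: "\<And>y. (p has_vector_derivative p' y) (at y)"
    and p': "\<And>y. (p' has_vector_derivative p'' y) (at y)"
  shows "((\<lambda>y. bump R y *\<^sub>R p'' y - bump'' R y *\<^sub>R p y) has_integral 0) {-R..R}"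
proof -
  let ?q = "\<lambda>y. bump R y *\<^sub>R p' y - bump' R y *\<^sub>R p y"
  have "(?q has_vector_derivative (bump R y *\<^sub>R p'' y - bump'' R y *\<^sub>R p y)) (at y within {-R..R})" for y
    by (rule derivative_eq_intros bump_has_real_derivative[OF R]
        has_vector_derivative_at_within[OF p] has_vector_derivative_at_within[OF p'] refl | simp)+
  then have "((\<lambda>y. bump R y *\<^sub>R p'' y - bump'' R y *\<^sub>R p y) has_integral (?q R - ?q (- R))) {-R..R}"
    using R by (intro fundamental_theorem_of_calculus) auto
  moreover have "bump R R = 0" "bump R (- R) = 0" "bump' R R = 0" "bump' R (- R) = 0"
    using R by (auto simp: bump_def bump'_def)
  ultimately show ?thesis by simp
qed

subsection \<open>Integral estimates\<close>

text \<open>Cauchy-Schwarz against the constant 1, obtained by integrating the square of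
  \<open>cmod (u y) - m\<close>, where \<open>m\<close> is the mean of
  \<open>cmod (u y)\<close>.\<close>

lemma integral_square_le:
  fixes u :: "real \<Rightarrow> complex"
  assumes h: "0 \<le> h" and u: "continuous_on {p..p + h} u"
  shows "(cmod (integral {p..p + h} u))\<^sup>2 \<le> h * integral {p..p + h} (\<lambda>y. (cmod (u y))\<^sup>2)"
proof (cases "h = 0")
  case False
  define m where "m = integral {p..p + h} (\<lambda>y. cmod (u y)) / h"
  have int: "u integrable_on {p..p + h}" "(\<lambda>y. cmod (u y)) integrable_on {p..p + h}"
    "(\<lambda>y. (cmod (u y))\<^sup>2) integrable_on {p..p + h}"
    by (intro integrable_continuous_interval continuous_intros u)+
  have "integral {p..p + h} (\<lambda>y. 2 * m * cmod (u y) - m\<^sup>2) \<le> integral {p..p + h} (\<lambda>y. (cmod (u y))\<^sup>2)"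
  proof (rule integral_le)
    show "(\<lambda>y. 2 * m * cmod (u y) - m\<^sup>2) integrable_on {p..p + h}"
      by (intro integrable_continuous_interval continuous_intros u)
    show "2 * m * cmod (u y) - m\<^sup>2 \<le> (cmod (u y))\<^sup>2" for y
      using zero_le_power2[of "cmod (u y) - m"] by (simp add: power2_diff algebra_simps)
  qed (rule int)
  also have "integral {p..p + h} (\<lambda>y. 2 * m * cmod (u y) - m\<^sup>2) = 2 * m * (m * h) - m\<^sup>2 * h"
    using int h False unfolding m_def
    by (subst integral_diff) (auto intro!: integrable_cmul simp: integrable_on_mult_right)
  finally have "h * (h * m\<^sup>2) \<le> h * integral {p..p + h} (\<lambda>y. (cmod (u y))\<^sup>2)"
    using h by (intro mult_left_mono) (auto simp: power2_eq_square algebra_simps)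
  moreover have "cmod (integral {p..p + h} u) \<le> h * m"
    using integral_norm_bound_integral[OF int(1,2)] False unfolding m_def by simp
  then have "(cmod (integral {p..p + h} u))\<^sup>2 \<le> (h * m)\<^sup>2"
    by (intro power_mono) auto
  ultimately show ?thesis by (simp add: power2_eq_square algebra_simps)
qed simp

text \<open>The difference is the integral of \<open>u'\<close> over an interval of length
  \<open>h\<close>. Cauchy-Schwarz gives one factor \<open>h\<close>; swapping the integrals gives
  the other, since every translate of \<open>{-R..R}\<close> by \<open>r \<in> {0..h}\<close> stays
  in the enlarged window.\<close>

lemma integral_difference_square_le:
  fixes u u' :: "real \<Rightarrow> complex"
  assumes h: "0 \<le> h" and R: "0 \<le> R" and u: "\<And>y. (u has_vector_derivative u' y) (at y)"
    and u': "continuous_on UNIV u'"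
  shows "integral {-R..R} (\<lambda>y. (cmod (u (y + h) - u y))\<^sup>2)
    \<le> h\<^sup>2 * integral {-(R + h)..R + h} (\<lambda>y. (cmod (u' y))\<^sup>2)"
proof -
  have cu: "continuous_on X u" for X
    using u by (intro continuous_at_imp_continuous_on ballI has_vector_derivative_continuous)
  have cu': "continuous_on X (\<lambda>x. u' (f x))" if "continuous_on X f" for X :: "'z::topological_space set" and f
    using continuous_on_compose2[OF u' that] by simp
  have cuh: "continuous_on X (\<lambda>y. u (y + h))" for X
    by (rule continuous_on_compose2[OF cu[of UNIV]]) (auto intro: continuous_intros)
  have shift: "integral {y..y + h} g = integral {0..h} (\<lambda>r. g (y + r))" if "continuous_on UNIV g" for g :: "real \<Rightarrow> real" and y
    using integral_shift_Icc_real[of 0 h g y] by (simp add: o_def add.commute)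
  have point: "(cmod (u (y + h) - u y))\<^sup>2 \<le> h * integral {0..h} (\<lambda>r. (cmod (u' (y + r)))\<^sup>2)" for y
  proof -
    have "(u' has_integral (u (y + h) - u y)) {y..y + h}"
      using h by (intro fundamental_theorem_of_calculus has_vector_derivative_at_within[OF u]) auto
    then have "u (y + h) - u y = integral {y..y + h} u'"
      by (simp add: integral_unique)
    then show ?thesis
      using integral_square_le[OF h, of y u'] cu'[of _ "\<lambda>x. x"] shift[of "\<lambda>y. (cmod (u' y))\<^sup>2" y]
      by (simp add: continuous_intros)
  qed
  have cont2: "continuous_on X (\<lambda>(y, r). (cmod (u' (y + r)))\<^sup>2)" for X
    unfolding case_prod_unfold by (intro continuous_intros cu')
  have "integral {-R..R} (\<lambda>y. (cmod (u (y + h) - u y))\<^sup>2)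
      \<le> integral {-R..R} (\<lambda>y. h * integral {0..h} (\<lambda>r. (cmod (u' (y + r)))\<^sup>2))"
  proof (rule integral_le)
    show "(\<lambda>y. (cmod (u (y + h) - u y))\<^sup>2) integrable_on {-R..R}"
      by (intro integrable_continuous_interval continuous_intros cuh cu)
    have "continuous_on {-R..R} (\<lambda>y. integral (cbox 0 h) (\<lambda>r. (cmod (u' (y + r)))\<^sup>2))"
      by (rule integral_continuous_on_param[OF cont2])
    then show "(\<lambda>y. h * integral {0..h} (\<lambda>r. (cmod (u' (y + r)))\<^sup>2)) integrable_on {-R..R}"
      by (intro integrable_continuous_interval continuous_intros) (simp_all)
  qed (rule point)
  also have "\<dots> = h * integral {-R..R} (\<lambda>y. integral {0..h} (\<lambda>r. (cmod (u' (y + r)))\<^sup>2))"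
    by simp
  finally have le: "integral {-R..R} (\<lambda>y. (cmod (u (y + h) - u y))\<^sup>2)
    \<le> h * integral {-R..R} (\<lambda>y. integral {0..h} (\<lambda>r. (cmod (u' (y + r)))\<^sup>2))" .
  have "integral {-R..R} (\<lambda>y. integral {0..h} (\<lambda>r. (cmod (u' (y + r)))\<^sup>2))
      = integral {0..h} (\<lambda>r. integral {-R..R} (\<lambda>y. (cmod (u' (y + r)))\<^sup>2))"
    using integral_swap_continuous[OF cont2, where a = "-R" and b = R and c = 0 and d = h] by simp
  also have "\<dots> \<le> integral {0..h} (\<lambda>r. integral {-(R + h)..R + h} (\<lambda>y. (cmod (u' y))\<^sup>2))"
  proof (rule integral_le)
    have "continuous_on {0..h} (\<lambda>r. integral (cbox (-R) R) (\<lambda>y. (cmod (u' (y + r)))\<^sup>2))"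
      by (rule integral_continuous_on_param) (unfold case_prod_unfold, intro continuous_intros cu')
    then show "(\<lambda>r. integral {-R..R} (\<lambda>y. (cmod (u' (y + r)))\<^sup>2)) integrable_on {0..h}"
      by (intro integrable_continuous_interval) simp
  next
    fix r assume r: "r \<in> {0..h}"
    have "integral {-R..R} (\<lambda>y. (cmod (u' (y + r)))\<^sup>2) = integral {-R + r..R + r} (\<lambda>y. (cmod (u' y))\<^sup>2)"
      using integral_shift_Icc_real[of "-R" R "\<lambda>y. (cmod (u' y))\<^sup>2" r] by (simp add: o_def add.commute)
    also have "\<dots> \<le> integral {-(R + h)..R + h} (\<lambda>y. (cmod (u' y))\<^sup>2)"
      using r by (intro integral_subset_le integrable_continuous_interval continuous_intros cu') auto
    finally show "integral {-R..R} (\<lambda>y. (cmod (u' (y + r)))\<^sup>2)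
      \<le> integral {-(R + h)..R + h} (\<lambda>y. (cmod (u' y))\<^sup>2)" .
  qed (rule integrable_const_ivl)
  also have "\<dots> = h * integral {-(R + h)..R + h} (\<lambda>y. (cmod (u' y))\<^sup>2)"
    using h by simp
  finally have "h * integral {-R..R} (\<lambda>y. integral {0..h} (\<lambda>r. (cmod (u' (y + r)))\<^sup>2))
    \<le> h * (h * integral {-(R + h)..R + h} (\<lambda>y. (cmod (u' y))\<^sup>2))"
    using h by (rule mult_left_mono)
  with le show ?thesis
    unfolding power2_eq_square[of h] mult.assoc by (rule order_trans)
qed

section \<open>L2 norms as limits of localised integrals\<close>

lemma L2_norm_square:
  "(L2_norm u)\<^sup>2 = (\<integral>y. (cmod (u y))\<^sup>2 \<partial>lborel)"
  unfolding L2_norm_def by (simp add: real_sqrt_pow2)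

lemma L2_norm_nonneg: "0 \<le> L2_norm u"
  unfolding L2_norm_def by simp

lemma integral_square_le_L2_norm:
  assumes "square_integrable u"
  shows "integral {p..q} (\<lambda>y. (cmod (u y))\<^sup>2) \<le> (L2_norm u)\<^sup>2"
proof -
  have int: "integrable lborel (\<lambda>y. (cmod (u y))\<^sup>2)"
    using assms unfolding square_integrable_def by blast
  then have "set_integrable lborel {p..q} (\<lambda>y. (cmod (u y))\<^sup>2)"
    unfolding set_integrable_def by (rule integrable_mult_indicator[rotated]) simp
  then have "integral {p..q} (\<lambda>y. (cmod (u y))\<^sup>2) = (LINT y:{p..q}|lborel. (cmod (u y))\<^sup>2)"
    by (simp add: set_borel_integral_eq_integral)
  also have "\<dots> \<le> (\<integral>y. (cmod (u y))\<^sup>2 \<partial>lborel)"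
    unfolding set_lebesgue_integral_def
    by (rule integral_mono[OF integrable_mult_indicator[OF _ int] int]) (auto simp: indicator_def)
  finally show ?thesis by (simp only: L2_norm_square)
qed

text \<open>The cutoffs tend to 1 pointwise and are bounded by 1, so dominated convergence along
  integer \<open>R\<close> applies while the error \<open>D / R\<^sup>2\<close> disappears.\<close>

lemma L2_norm_square_le_if_local:
  fixes u :: "real \<Rightarrow> complex"
  assumes u: "square_integrable u"
    and le: "\<And>R. 0 < R \<Longrightarrow> integral {-R..R} (\<lambda>y. bump R y * (cmod (u y))\<^sup>2) \<le> X + D / R\<^sup>2"
  shows "(L2_norm u)\<^sup>2 \<le> X"
proof -
  let ?w = "\<lambda>n y. indicator {-real n..real n} y * (bump (real n) y * (cmod (u y))\<^sup>2)"
  have int: "integrable lborel (\<lambda>y. (cmod (u y))\<^sup>2)" and m [measurable]: "u \<in> borel_measurable lborel"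
    using u unfolding square_integrable_def by blast+
  have mb [measurable]: "bump R \<in> borel_measurable lborel" for R
    using borel_measurable_continuous_onI[OF continuous_on_bump(1)] by simp
  have bound: "norm (?w n y) \<le> (cmod (u y))\<^sup>2" for n y
  proof (cases "y \<in> {-real n..real n} \<and> n > 0")
    case True
    then have "bump (real n) y * (cmod (u y))\<^sup>2 \<le> 1 * (cmod (u y))\<^sup>2"
      by (intro mult_right_mono bump_le_one) auto
    then show ?thesis by (auto simp: indicator_def bump_nonneg)
  next
    \<comment> \<open>For \<open>n = 0\<close> division by zero gives \<open>bump 0 y = 1\<close>,
      so the bound still holds; otherwise the indicator is 0.\<close>
    case False
    then show ?thesis by (auto simp: indicator_def bump_def)
  qed
  have wint: "integrable lborel (?w n)" for n
  proof (rule Bochner_Integration.integrable_bound[OF int _ AE_I2])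
    show "norm (?w n y) \<le> norm ((cmod (u y))\<^sup>2)" for y
      using bound[of n y] by simp
  qed simp
  have "(\<lambda>n. \<integral>y. ?w n y \<partial>lborel) \<longlonglongrightarrow> (\<integral>y. (cmod (u y))\<^sup>2 \<partial>lborel)"
  proof (rule integral_dominated_convergence[where w = "\<lambda>y. (cmod (u y))\<^sup>2"])
    show "AE y in lborel. (\<lambda>n. ?w n y) \<longlonglongrightarrow> (cmod (u y))\<^sup>2"
    proof (rule AE_I2)
      fix y
      have "eventually (\<lambda>n. ?w n y = (1 - (y / real n)\<^sup>2)\<^sup>2 * (cmod (u y))\<^sup>2) sequentially"
        using eventually_ge_at_top[of "nat \<lceil>\<bar>y\<bar>\<rceil>"]
      proof eventually_elim
        case (elim n)
        then have "\<bar>y\<bar> \<le> real n" by linarith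
        then show ?case by (auto simp: bump_def indicator_def abs_le_iff)
      qed
      moreover have "(\<lambda>n. (1 - (y / real n)\<^sup>2)\<^sup>2 * (cmod (u y))\<^sup>2) \<longlonglongrightarrow> (1 - 0\<^sup>2)\<^sup>2 * (cmod (u y))\<^sup>2"
        by (intro tendsto_intros lim_const_over_n)
      ultimately show "(\<lambda>n. ?w n y) \<longlonglongrightarrow> (cmod (u y))\<^sup>2"
        by (subst tendsto_cong) simp_all
    qed
    show "AE y in lborel. norm (?w n y) \<le> (cmod (u y))\<^sup>2" for n
      using bound by simp
  qed (use int in auto)
  moreover have "(\<lambda>n. X + D * (1 / real n)\<^sup>2) \<longlonglongrightarrow> X + D * 0\<^sup>2"
    by (intro tendsto_intros lim_const_over_n)
  then have "(\<lambda>n. X + D / (real n)\<^sup>2) \<longlonglongrightarrow> X"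
    by (simp add: power_one_over)
  moreover have "(\<integral>y. ?w n y \<partial>lborel) \<le> X + D / (real n)\<^sup>2" if "n > 0" for n
  proof -
    have "set_integrable lborel {-real n..real n} (\<lambda>y. bump (real n) y * (cmod (u y))\<^sup>2)"
      using wint[of n] unfolding set_integrable_def by simp
    from set_borel_integral_eq_integral(2)[OF this] le[of "real n"] that
    show ?thesis by (simp add: set_lebesgue_integral_def)
  qed
  then have "eventually (\<lambda>n. (\<integral>y. ?w n y \<partial>lborel) \<le> X + D / (real n)\<^sup>2) sequentially"
    by (rule eventually_mono[OF eventually_gt_at_top[of "0::nat"]])
  ultimately have "(\<integral>y. (cmod (u y))\<^sup>2 \<partial>lborel) \<le> X"
    by (intro tendsto_le[OF sequentially_bot])
  then show ?thesis by (simp add: L2_norm_square)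
qed

subsection \<open>Localised energy and cross term\<close>

text \<open>The undamped equation on a closed time window on which all derivatives are continuous up
  to both ends. For a mode solution such a window must start at a positive time.\<close>

locale advection_diffusion =
  fixes a b \<nu> \<kappa> :: real and V :: "real \<Rightarrow> real \<Rightarrow> real"
    and f ft fy fyy :: "real \<Rightarrow> real \<Rightarrow> complex"
  assumes \<nu>_pos: "0 < \<nu>"
    and cont_V: "t \<in> {a..b} \<Longrightarrow> continuous_on UNIV (V t)"
    and cont_f: "continuous_on ({a..b} \<times> UNIV) (\<lambda>(t, y). f t y)"
    and cont_ft: "continuous_on ({a..b} \<times> UNIV) (\<lambda>(t, y). ft t y)"
    and cont_fy: "continuous_on ({a..b} \<times> UNIV) (\<lambda>(t, y). fy t y)"
    and cont_fyy: "continuous_on ({a..b} \<times> UNIV) (\<lambda>(t, y). fyy t y)"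
    and deriv_t: "t \<in> {a..b} \<Longrightarrow> ((\<lambda>s. f s y) has_vector_derivative ft t y) (at t within {a..b})"
    and deriv_y: "t \<in> {a..b} \<Longrightarrow> (f t has_vector_derivative fy t y) (at y)"
    and deriv_yy: "t \<in> {a..b} \<Longrightarrow> (fy t has_vector_derivative fyy t y) (at y)"
    and equation: "t \<in> {a..b} \<Longrightarrow> ft t y = of_real \<nu> * fyy t y - \<i> * of_real (\<kappa> * V t y) * f t y"
begin

lemma cont_slice:
  assumes "t \<in> {a..b}"
  shows "continuous_on X (f t)" "continuous_on X (ft t)" "continuous_on X (fy t)" "continuous_on X (fyy t)"
    "continuous_on X (V t)"
  using assms continuous_on_slice_snd cont_f cont_ft cont_fy cont_fyy
    continuous_on_subset[OF cont_V subset_UNIV] by blast+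

text \<open>A translate of a solution solves the equation with the translated velocity, so the cross
  term is an inner product of two solutions with different velocities.\<close>

lemma shift:
  "advection_diffusion a b \<nu> \<kappa> (\<lambda>t y. V t (y + h)) (\<lambda>t y. f t (y + h)) (\<lambda>t y. ft t (y + h))
     (\<lambda>t y. fy t (y + h)) (\<lambda>t y. fyy t (y + h))"
proof
  have c: "continuous_on ({a..b} \<times> UNIV) (\<lambda>(t, y). g t (y + h))"
    if "continuous_on ({a..b} \<times> UNIV) (\<lambda>(t, y). g t y)" for g :: "real \<Rightarrow> real \<Rightarrow> complex"
  proof -
    have "continuous_on ({a..b} \<times> UNIV) (\<lambda>p :: real \<times> real. (\<lambda>(t, y). g t y) (fst p, snd p + h))"
      by (rule continuous_on_compose2[OF that]) (auto intro!: continuous_intros)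
    then show ?thesis by (simp add: case_prod_unfold)
  qed
  show "continuous_on ({a..b} \<times> UNIV) (\<lambda>(t, y). f t (y + h))"
    "continuous_on ({a..b} \<times> UNIV) (\<lambda>(t, y). ft t (y + h))"
    "continuous_on ({a..b} \<times> UNIV) (\<lambda>(t, y). fy t (y + h))"
    "continuous_on ({a..b} \<times> UNIV) (\<lambda>(t, y). fyy t (y + h))"
    by (intro c cont_f cont_ft cont_fy cont_fyy)+
  have d: "((\<lambda>y. g (y + h)) has_vector_derivative g' (y + h)) (at y)"
    if "\<And>y. (g has_vector_derivative g' y) (at y)" for g g' :: "real \<Rightarrow> complex" and y
    using vector_diff_chain_at[of "\<lambda>y. y + h" 1 y g "g' (y + h)"] that
    by (simp add: o_def has_vector_derivative_add_const)
  fix t y assume t: "t \<in> {a..b}"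
  show "continuous_on UNIV (\<lambda>y. V t (y + h))"
    by (rule continuous_on_compose2[OF cont_V[OF t]]) (auto intro: continuous_intros)
  show "((\<lambda>y. f t (y + h)) has_vector_derivative fy t (y + h)) (at y)"
    "((\<lambda>y. fy t (y + h)) has_vector_derivative fyy t (y + h)) (at y)"
    by (intro d deriv_y deriv_yy t)+
  show "((\<lambda>s. f s (y + h)) has_vector_derivative ft t (y + h)) (at t within {a..b})"
    by (rule deriv_t[OF t])
  show "ft t (y + h) = of_real \<nu> * fyy t (y + h) - \<i> * of_real (\<kappa> * V t (y + h)) * f t (y + h)"
    by (rule equation[OF t])
qed (rule \<nu>_pos)

end

definition local_inner :: "real \<Rightarrow> (real \<Rightarrow> complex) \<Rightarrow> (real \<Rightarrow> complex) \<Rightarrow> complex" where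
  "local_inner R u w = integral {-R..R} (\<lambda>y. bump R y *\<^sub>R (u y * cnj (w y)))"

text \<open>The integrand of the time derivative of \<open>local_inner\<close> for two solutions,
  after second derivatives have been moved onto the cutoff; \<open>d\<close> stands for
  \<open>\<kappa>\<close> times the difference of the velocities.\<close>

definition local_flux ::
  "real \<Rightarrow> real \<Rightarrow> (real \<Rightarrow> real) \<Rightarrow> (real \<Rightarrow> complex) \<Rightarrow> (real \<Rightarrow> complex) \<Rightarrow>
     (real \<Rightarrow> complex) \<Rightarrow> (real \<Rightarrow> complex) \<Rightarrow> real \<Rightarrow> complex" where
  "local_flux R \<nu> d u w uy wy y =
     \<nu> *\<^sub>R (bump'' R y *\<^sub>R (u y * cnj (w y)) - (2 * bump R y) *\<^sub>R (uy y * cnj (wy y)))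
       - (bump R y * d y) *\<^sub>R (\<i> * (u y * cnj (w y)))"

lemma continuous_on_local_flux:
  assumes "continuous_on S d" "continuous_on S u" "continuous_on S w" "continuous_on S uy" "continuous_on S wy"
  shows "continuous_on S (local_flux R \<nu> d u w uy wy)"
  unfolding local_flux_def[abs_def] by (intro continuous_intros assms)

text \<open>One computation serves both the energy (\<open>u = w\<close>) and the cross term. With
  \<open>p\<close> the product of \<open>u\<close> and the conjugate of \<open>w\<close>, the
  diffusion terms are \<open>\<nu>\<close> times \<open>p''\<close> minus twice the product of the
  gradients, and the cutoff absorbs \<open>p''\<close> by parts.\<close>

lemma local_inner_has_vector_derivative:
  assumes "advection_diffusion a b \<nu> \<kappa> V u ut uy uyy" "advection_diffusion a b \<nu> \<kappa> W w wt wy wyy"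
    and R: "0 < R" and t: "t \<in> {a..b}"
  shows "((\<lambda>s. local_inner R (u s) (w s)) has_vector_derivative
    integral {-R..R} (local_flux R \<nu> (\<lambda>y. \<kappa> * (V t y - W t y)) (u t) (w t) (uy t) (wy t)))
    (at t within {a..b})"
proof -
  interpret u: advection_diffusion a b \<nu> \<kappa> V u ut uy uyy by fact
  interpret w: advection_diffusion a b \<nu> \<kappa> W w wt wy wyy by fact
  let ?D = "\<lambda>s y. bump R y *\<^sub>R (ut s y * cnj (w s y) + u s y * cnj (wt s y))"
  have c: "continuous_on ({a..b} \<times> X) (\<lambda>p. g (fst p) (snd p))"
    if "continuous_on ({a..b} \<times> UNIV) (\<lambda>(t, y). g t y)" for g :: "real \<Rightarrow> real \<Rightarrow> complex" and X
    using continuous_on_subset[OF that, of "{a..b} \<times> X"] by (auto simp: case_prod_unfold)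
  have cb: "continuous_on X (\<lambda>p. bump R (snd p))" for X :: "(real \<times> real) set"
    by (rule continuous_on_compose2[OF continuous_on_bump(1)[of UNIV]]) (auto intro: continuous_intros)
  have "((\<lambda>s. integral (cbox (-R) R) (\<lambda>y. bump R y *\<^sub>R (u s y * cnj (w s y)))) has_vector_derivative
      integral (cbox (-R) R) (?D t)) (at t within {a..b})"
  proof (rule leibniz_rule_vector_derivative)
    fix s y assume s: "s \<in> {a..b}"
    show "((\<lambda>s. bump R y *\<^sub>R (u s y * cnj (w s y))) has_vector_derivative ?D s y) (at s within {a..b})"
      by (rule derivative_eq_intros has_vector_derivative_cnj u.deriv_t[OF s] w.deriv_t[OF s] refl | simp add: algebra_simps)+
  next
    fix s assume s: "s \<in> {a..b}"
    show "(\<lambda>y. bump R y *\<^sub>R (u s y * cnj (w s y))) integrable_on cbox (-R) R"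
      by (intro integrable_continuous continuous_intros u.cont_slice w.cont_slice s)
  next
    show "continuous_on ({a..b} \<times> cbox (-R) R) (\<lambda>(s, y). ?D s y)"
      unfolding case_prod_unfold
      by (intro continuous_intros c cb u.cont_f u.cont_ft w.cont_f w.cont_ft)
  qed (use t in auto)
  moreover have "integral {-R..R} (?D t)
    = integral {-R..R} (local_flux R \<nu> (\<lambda>y. \<kappa> * (V t y - W t y)) (u t) (w t) (uy t) (wy t))"
    (is "_ = integral _ ?F")
  proof -
    let ?p = "\<lambda>y. u t y * cnj (w t y)"
    let ?p' = "\<lambda>y. uy t y * cnj (w t y) + u t y * cnj (wy t y)"
    let ?p'' = "\<lambda>y. uyy t y * cnj (w t y) + 2 * (uy t y * cnj (wy t y)) + u t y * cnj (wyy t y)"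
    have "((\<lambda>y. bump R y *\<^sub>R ?p'' y - bump'' R y *\<^sub>R ?p y) has_integral 0) {-R..R}"
    proof (rule integral_bump_by_parts[OF R])
      fix y
      show "(?p has_vector_derivative ?p' y) (at y)"
        by (rule derivative_eq_intros has_vector_derivative_cnj u.deriv_y[OF t] w.deriv_y[OF t] refl | simp add: algebra_simps)+
      show "(?p' has_vector_derivative ?p'' y) (at y)"
        by (rule derivative_eq_intros has_vector_derivative_cnj u.deriv_y[OF t] w.deriv_y[OF t]
            u.deriv_yy[OF t] w.deriv_yy[OF t] refl | simp add: algebra_simps)+
    qed
    moreover have "?D t y = ?F y + \<nu> *\<^sub>R (bump R y *\<^sub>R ?p'' y - bump'' R y *\<^sub>R ?p y)" for y
      unfolding local_flux_def u.equation[OF t] w.equation[OF t]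
      by (simp add: scaleR_conv_of_real algebra_simps)
    moreover have "?F integrable_on {-R..R}"
      by (intro integrable_continuous_interval continuous_on_local_flux continuous_intros u.cont_slice w.cont_slice t)
    then have "(?F has_integral integral {-R..R} ?F) {-R..R}"
      by (rule integrable_integral)
    ultimately have "(?D t has_integral (integral {-R..R} ?F + \<nu> *\<^sub>R 0)) {-R..R}"
      by (simp only: has_integral_add has_integral_cmul)
    then show ?thesis by (simp add: integral_unique)
  qed
  ultimately show ?thesis
    by (simp add: local_inner_def)
qed

lemma Re_local_inner_self:
  assumes "continuous_on {-R..R} u"
  shows "Re (local_inner R u u) = integral {-R..R} (\<lambda>y. bump R y * (cmod (u y))\<^sup>2)"
proof -
  have "(\<lambda>y. bump R y *\<^sub>R (u y * cnj (u y))) integrable_on {-R..R}"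
    by (intro integrable_continuous_interval continuous_intros assms)
  from integral_linear[OF this bounded_linear_Re] show ?thesis
    unfolding local_inner_def by (simp add: o_def complex_norm_square[symmetric])
qed

lemma Re_local_inner_self_le:
  assumes "0 < R" "continuous_on {-R..R} u" "square_integrable u"
  shows "Re (local_inner R u u) \<le> (L2_norm u)\<^sup>2"
proof -
  have "integral {-R..R} (\<lambda>y. bump R y * (cmod (u y))\<^sup>2) \<le> integral {-R..R} (\<lambda>y. (cmod (u y))\<^sup>2)"
    by (intro integral_le integrable_continuous_interval continuous_intros assms)
      (use assms bump_le_one in \<open>auto intro!: mult_left_le_one_le simp: bump_nonneg\<close>)
  also have "\<dots> \<le> (L2_norm u)\<^sup>2"
    by (rule integral_square_le_L2_norm[OF assms(3)])
  finally show ?thesis using assms by (simp add: Re_local_inner_self)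
qed

lemma Re_local_inner_self_nonneg:
  assumes "continuous_on {-R..R} u"
  shows "0 \<le> Re (local_inner R u u)"
  using assms by (auto simp: Re_local_inner_self bump_nonneg intro!: Henstock_Kurzweil_Integration.integral_nonneg
      integrable_continuous_interval continuous_intros)

lemma integral_shifted_square_le_L2_norm:
  assumes "square_integrable u"
  shows "integral {p..q} (\<lambda>y. (cmod (u (y + h)))\<^sup>2) \<le> (L2_norm u)\<^sup>2"
  using integral_shift_Icc_real[of p q "\<lambda>y. (cmod (u y))\<^sup>2" h]
    integral_square_le_L2_norm[OF assms, of "p + h" "q + h"] by (simp add: o_def add.commute)

text \<open>By the arithmetic-geometric mean inequality and translation invariance. It bounds the
  cross term at both ends of a time window.\<close>

lemma cmod_local_inner_shift_le:
  assumes R: "0 < R" and u: "continuous_on UNIV u" "square_integrable u"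
  shows "cmod (local_inner R (\<lambda>y. u (y + h)) u) \<le> (L2_norm u)\<^sup>2"
proof -
  have c: "continuous_on X u" "continuous_on X (\<lambda>y. u (y + h))" for X
    by (auto intro!: continuous_on_compose2[OF u(1)] continuous_intros continuous_on_subset[OF u(1)])
  have "cmod (local_inner R (\<lambda>y. u (y + h)) u)
    \<le> integral {-R..R} (\<lambda>y. 1 / 2 * (cmod (u (y + h)))\<^sup>2 + 1 / 2 * (cmod (u y))\<^sup>2)"
    unfolding local_inner_def
  proof (rule integral_norm_bound_integral)
    fix y assume y: "y \<in> {-R..R}"
    have "cmod (bump R y *\<^sub>R (u (y + h) * cnj (u y))) \<le> 1 * (cmod (u (y + h)) * cmod (u y))"
      unfolding norm_scaleR norm_mult complex_mod_cnj
      using bump_le_one[OF y R] bump_nonneg[of R y] by (intro mult_right_mono) auto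
    also have "\<dots> \<le> 1 / 2 * (cmod (u (y + h)))\<^sup>2 + 1 / 2 * (cmod (u y))\<^sup>2"
      using zero_le_power2[of "cmod (u (y + h)) - cmod (u y)"] unfolding power2_diff by linarith
    finally show "cmod (bump R y *\<^sub>R (u (y + h) * cnj (u y))) \<le> \<dots>" .
  qed (intro integrable_continuous_interval continuous_intros c)+
  also have "\<dots> = 1 / 2 * integral {-R..R} (\<lambda>y. (cmod (u (y + h)))\<^sup>2)
      + 1 / 2 * integral {-R..R} (\<lambda>y. (cmod (u y))\<^sup>2)"
    by (subst integral_add) (auto intro!: integrable_continuous_interval continuous_intros c)
  also have "\<dots> \<le> (L2_norm u)\<^sup>2"
    using integral_shifted_square_le_L2_norm[OF u(2), of "-R" R h]
      integral_square_le_L2_norm[OF u(2), of "-R" R] by linarith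
  finally show ?thesis .
qed

lemma decrease_if_derivative_le:
  fixes g :: "real \<Rightarrow> real"
  assumes "a \<le> b"
    and "\<And>t. t \<in> {a..b} \<Longrightarrow> (g has_vector_derivative g' t) (at t within {a..b})"
    and "\<And>t. t \<in> {a..b} \<Longrightarrow> g' t \<le> L"
  shows "g b \<le> g a + L * (b - a)"
proof -
  have "(g' has_integral (g b - g a)) {a..b}"
    using assms by (intro fundamental_theorem_of_calculus) auto
  moreover have "((\<lambda>t. L) has_integral (b - a) * L) {a..b}"
    using has_integral_const_real[of L a b] assms(1) by simp
  ultimately have "g b - g a \<le> (b - a) * L"
    using assms(3) by (rule has_integral_le) auto
  then show ?thesis by (simp add: algebra_simps)
qed

section \<open>Energy dissipation and the mixing estimate\<close>

locale bounded_advection_diffusion = advection_diffusion +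
  fixes B :: real
  assumes square_int: "t \<in> {a..b} \<Longrightarrow> square_integrable (f t)"
    and L2_bound: "t \<in> {a..b} \<Longrightarrow> L2_norm (f t) \<le> B"
begin

definition energy :: "real \<Rightarrow> real \<Rightarrow> real" where
  "energy R t = Re (local_inner R (f t) (f t))"

text \<open>The vanishing difference \<open>V t y - V t y\<close> is kept so that the general
  derivative formula applies verbatim.\<close>

definition energy_rate :: "real \<Rightarrow> real \<Rightarrow> real" where
  "energy_rate R t = Re (integral {-R..R}
     (local_flux R \<nu> (\<lambda>y. \<kappa> * (V t y - V t y)) (f t) (f t) (fy t) (fy t)))"

lemma energy_has_vector_derivative:
  assumes "0 < R" "t \<in> {a..b}"
  shows "(energy R has_vector_derivative energy_rate R t) (at t within {a..b})"
  unfolding energy_def[abs_def] energy_rate_def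
  by (rule bounded_linear.has_vector_derivative[OF bounded_linear_Re
        local_inner_has_vector_derivative[OF advection_diffusion_axioms advection_diffusion_axioms assms]])

lemma L2_square_bound: "t \<in> {a..b} \<Longrightarrow> (L2_norm (f t))\<^sup>2 \<le> B\<^sup>2"
  using L2_bound by (auto intro: power_mono L2_norm_nonneg)

text \<open>With equal velocities transport cancels, leaving the dissipation and the cutoff term.
  The bound \<open>B\<close> enters only through cutoff errors of order
  \<open>B\<^sup>2 / R\<^sup>2\<close>.\<close>

lemma energy_rate_le:
  assumes R: "0 < R" and t: "t \<in> {a..b}"
  shows "energy_rate R t
    \<le> 8 * \<nu> * B\<^sup>2 / R\<^sup>2 - 2 * \<nu> * integral {-R..R} (\<lambda>y. bump R y * (cmod (fy t y))\<^sup>2)"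
proof -
  let ?F = "local_flux R \<nu> (\<lambda>y. \<kappa> * (V t y - V t y)) (f t) (f t) (fy t) (fy t)"
  let ?u = "\<lambda>y. (cmod (f t y))\<^sup>2" and ?u' = "\<lambda>y. bump R y * (cmod (fy t y))\<^sup>2"
  have F: "?F integrable_on {-R..R}"
    by (intro integrable_continuous_interval continuous_on_local_flux continuous_intros cont_slice t)
  have "energy_rate R t = integral {-R..R} (Re \<circ> ?F)"
    unfolding energy_rate_def by (rule integral_linear[OF F bounded_linear_Re, symmetric])
  also have "\<dots> \<le> integral {-R..R} (\<lambda>y. 8 * \<nu> / R\<^sup>2 * ?u y - 2 * \<nu> * ?u' y)"
  proof (rule integral_le)
    show "(Re \<circ> ?F) integrable_on {-R..R}"
      by (rule integrable_linear[OF F bounded_linear_Re])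
    show "(\<lambda>y. 8 * \<nu> / R\<^sup>2 * ?u y - 2 * \<nu> * ?u' y) integrable_on {-R..R}"
      by (intro integrable_continuous_interval continuous_intros cont_slice t)
    fix y assume y: "y \<in> {-R..R}"
    have "\<nu> * (bump'' R y * ?u y) \<le> \<nu> * (8 / R\<^sup>2 * ?u y)"
      using abs_bump''_le[OF y R] \<nu>_pos by (intro mult_left_mono mult_right_mono) auto
    moreover have "(Re \<circ> ?F) y = \<nu> * (bump'' R y * ?u y) - 2 * \<nu> * ?u' y"
      unfolding local_flux_def by (simp add: complex_norm_square[symmetric] algebra_simps)
    moreover have "\<nu> * (8 / R\<^sup>2 * ?u y) = 8 * \<nu> / R\<^sup>2 * ?u y"
      by simp
    ultimately show "(Re \<circ> ?F) y \<le> 8 * \<nu> / R\<^sup>2 * ?u y - 2 * \<nu> * ?u' y"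
      by linarith
  qed
  also have "\<dots> = 8 * \<nu> / R\<^sup>2 * integral {-R..R} ?u - 2 * \<nu> * integral {-R..R} ?u'"
    using R by (subst integral_diff)
      (auto intro!: integrable_continuous_interval continuous_intros cont_slice t)
  also have "8 * \<nu> / R\<^sup>2 * integral {-R..R} ?u \<le> 8 * \<nu> / R\<^sup>2 * B\<^sup>2"
    using \<nu>_pos order_trans[OF integral_square_le_L2_norm[OF square_int[OF t]] L2_square_bound[OF t]]
    by (intro mult_left_mono) auto
  finally show ?thesis by simp
qed

lemma energy_almost_decreasing:
  assumes R: "0 < R" and "s \<in> {a..b}" "t \<in> {a..b}" "s \<le> t"
  shows "energy R t \<le> energy R s + 8 * \<nu> * B\<^sup>2 / R\<^sup>2 * (t - s)"
proof (rule decrease_if_derivative_le[where g' = "energy_rate R"])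
  fix r assume r: "r \<in> {s..t}"
  show "(energy R has_vector_derivative energy_rate R r) (at r within {s..t})"
    by (rule has_vector_derivative_within_subset[OF energy_has_vector_derivative[OF R]])
      (use r assms in auto)
  have r': "r \<in> {a..b}"
    using r assms by auto
  have "0 \<le> integral {-R..R} (\<lambda>y. bump R y * (cmod (fy r y))\<^sup>2)"
    by (intro Henstock_Kurzweil_Integration.integral_nonneg integrable_continuous_interval
        continuous_intros cont_slice r') (simp add: bump_nonneg)
  then have "0 \<le> 2 * \<nu> * integral {-R..R} (\<lambda>y. bump R y * (cmod (fy r y))\<^sup>2)"
    using \<nu>_pos by simp
  then show "energy_rate R r \<le> 8 * \<nu> * B\<^sup>2 / R\<^sup>2"
    using energy_rate_le[OF R r'] by linarith
qed fact

lemma energy_eq: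
  "t \<in> {a..b} \<Longrightarrow> energy R t = integral {-R..R} (\<lambda>y. bump R y * (cmod (f t y))\<^sup>2)"
  unfolding energy_def by (intro Re_local_inner_self cont_slice)

lemma energy_le_L2: "0 < R \<Longrightarrow> t \<in> {a..b} \<Longrightarrow> energy R t \<le> (L2_norm (f t))\<^sup>2"
  unfolding energy_def by (intro Re_local_inner_self_le cont_slice square_int)

text \<open>The localised energy can grow only by its cutoff error, which vanishes as
  \<open>R\<close> tends to infinity.\<close>

lemma L2_norm_square_decreasing:
  assumes "s \<in> {a..b}" "t \<in> {a..b}" "s \<le> t"
  shows "(L2_norm (f t))\<^sup>2 \<le> (L2_norm (f s))\<^sup>2"
proof (rule L2_norm_square_le_if_local[OF square_int])
  fix R :: real assume R: "0 < R"
  have "energy R t \<le> (L2_norm (f s))\<^sup>2 + 8 * \<nu> * B\<^sup>2 / R\<^sup>2 * (t - s)"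
    using energy_almost_decreasing[OF R assms] energy_le_L2[OF R, of s] assms by simp
  then show "integral {-R..R} (\<lambda>y. bump R y * (cmod (f t y))\<^sup>2)
    \<le> (L2_norm (f s))\<^sup>2 + (8 * \<nu> * B\<^sup>2 * (t - s)) / R\<^sup>2"
    using assms by (simp add: energy_eq)
qed fact

definition cross_rate :: "real \<Rightarrow> real \<Rightarrow> real \<Rightarrow> real" where
  "cross_rate h R t = Im (integral {-R..R} (local_flux R \<nu> (\<lambda>y. \<kappa> * (V t (y + h) - V t y))
     (\<lambda>y. f t (y + h)) (f t) (\<lambda>y. fy t (y + h)) (fy t)))"

lemma cross_has_vector_derivative:
  assumes "0 < R" "t \<in> {a..b}"
  shows "((\<lambda>t. Im (local_inner R (\<lambda>y. f t (y + h)) (f t))) has_vector_derivative cross_rate h R t)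
    (at t within {a..b})"
  unfolding cross_rate_def
  by (rule bounded_linear.has_vector_derivative[OF bounded_linear_Im
        local_inner_has_vector_derivative[OF shift advection_diffusion_axioms assms]])

text \<open>The sign \<open>s\<close> makes the velocity difference nonnegative, so transport
  supplies the damping term in \<open>\<alpha>\<close>. The gradient integral pays for diffusion and
  for replacing \<open>f t (y + h)\<close> by \<open>f t y\<close>.\<close>

lemma cross_rate_le:
  assumes R: "0 < R" and t: "t \<in> {a..b}" and h: "0 < h" and \<alpha>: "0 \<le> \<alpha>" and s: "s \<in> {1, -1}"
    and V: "\<And>y. \<alpha> \<le> s * (\<kappa> * (V t (y + h) - V t y))" "\<And>y. s * (\<kappa> * (V t (y + h) - V t y)) \<le> \<beta>"
  shows "s * cross_rate h R t
    \<le> 8 * \<nu> * B\<^sup>2 / R\<^sup>2 - \<alpha> / 2 * energy R t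
      + (2 * \<nu> + \<beta> / 2 * h\<^sup>2) * integral {-(R + h)..R + h} (\<lambda>y. (cmod (fy t y))\<^sup>2)"
proof -
  let ?d = "\<lambda>y. \<kappa> * (V t (y + h) - V t y)"
  let ?F = "local_flux R \<nu> ?d (\<lambda>y. f t (y + h)) (f t) (\<lambda>y. fy t (y + h)) (fy t)"
  let ?f = "\<lambda>y. (cmod (f t y))\<^sup>2" and ?g = "\<lambda>y. (cmod (f t (y + h)))\<^sup>2"
  let ?f' = "\<lambda>y. (cmod (fy t y))\<^sup>2" and ?g' = "\<lambda>y. (cmod (fy t (y + h)))\<^sup>2"
  let ?e = "\<lambda>y. (cmod (f t (y + h) - f t y))\<^sup>2"
  define W where "W = integral {-(R + h)..R + h} ?f'"
  have \<beta>: "0 \<le> \<beta>"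
    using V[of 0] \<alpha> by linarith
  interpret shifted: advection_diffusion a b \<nu> \<kappa> "\<lambda>t y. V t (y + h)" "\<lambda>t y. f t (y + h)"
    "\<lambda>t y. ft t (y + h)" "\<lambda>t y. fy t (y + h)" "\<lambda>t y. fyy t (y + h)"
    by (rule shift)
  note c = cont_slice[OF t] shifted.cont_slice[OF t]
  have F: "?F integrable_on {-R..R}"
    by (intro integrable_continuous_interval continuous_on_local_flux continuous_intros c)
  let ?I = "\<lambda>y. s * Im (?F y)"
  \<comment> \<open>A pointwise majorant: the cutoff and gradient products are split evenly between
    the solution and its translate, and the last two terms come from transport.\<close>
  let ?J = "\<lambda>y. 4 * \<nu> / R\<^sup>2 * ?f y + 4 * \<nu> / R\<^sup>2 * ?g y + \<nu> * ?f' y + \<nu> * ?g' y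
      + \<beta> / 2 * ?e y - \<alpha> / 2 * (bump R y * ?f y)"
  have "s * cross_rate h R t = integral {-R..R} (\<lambda>y. s *\<^sub>R (Im \<circ> ?F) y)"
    unfolding cross_rate_def integral_linear[OF F bounded_linear_Im, symmetric] by (simp add: o_def)
  also have "\<dots> \<le> integral {-R..R} ?J"
  proof (rule integral_le)
    show "(\<lambda>y. s *\<^sub>R (Im \<circ> ?F) y) integrable_on {-R..R}"
      by (intro integrable_cmul integrable_linear[OF F bounded_linear_Im])
    show "?J integrable_on {-R..R}"
      by (intro integrable_continuous_interval continuous_intros c)
    fix y assume y: "y \<in> {-R..R}"
    define z w z' w' where zw: "z = f t (y + h)" "w = f t y" "z' = fy t (y + h)" "w' = fy t y"
    define p where "p = s * ?d y"
    have s1: "\<bar>s\<bar> = 1" using s by auto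
    have product: "2 * \<bar>s * Im (x * cnj x')\<bar> \<le> (cmod x)\<^sup>2 + (cmod x')\<^sup>2" for x x'
    proof -
      have "\<bar>s * Im (x * cnj x')\<bar> \<le> cmod x * cmod x'"
        using abs_Im_le_cmod[of "x * cnj x'"] s1 by (simp add: abs_mult norm_mult)
      then show ?thesis
        using zero_le_power2[of "cmod x - cmod x'"] unfolding power2_diff by linarith
    qed
    define i i' where "i = s * Im (z * cnj w)" and "i' = s * Im (z' * cnj w')"
    have "\<nu> * (bump'' R y * i) \<le> \<nu> * (8 / R\<^sup>2 * (((cmod z)\<^sup>2 + (cmod w)\<^sup>2) / 2))"
    proof (intro mult_left_mono)
      have "bump'' R y * i \<le> \<bar>bump'' R y\<bar> * \<bar>i\<bar>"
        by (metis abs_ge_self abs_mult)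
      also have "\<dots> \<le> 8 / R\<^sup>2 * (((cmod z)\<^sup>2 + (cmod w)\<^sup>2) / 2)"
        using abs_bump''_le[OF y R] product[of z w, folded i_def] by (intro mult_mono) auto
      finally show "bump'' R y * i \<le> \<dots>" .
    qed (use \<nu>_pos in simp)
    moreover have "- (\<nu> * (2 * bump R y * i')) \<le> \<nu> * ((cmod z')\<^sup>2 + (cmod w')\<^sup>2)"
    proof -
      have "- (bump R y * (2 * i')) \<le> bump R y * (2 * \<bar>i'\<bar>)"
        using mult_left_mono[OF abs_ge_minus_self[of "2 * i'"] bump_nonneg[of R y]] by (simp add: abs_mult)
      also have "\<dots> \<le> 1 * ((cmod z')\<^sup>2 + (cmod w')\<^sup>2)"
        using bump_le_one[OF y R] bump_nonneg[of R y] product[of z' w', folded i'_def] by (intro mult_mono) auto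
      finally have "\<nu> * - (bump R y * (2 * i')) \<le> \<nu> * (1 * ((cmod z')\<^sup>2 + (cmod w')\<^sup>2))"
        using \<nu>_pos by (intro mult_left_mono) auto
      then show ?thesis by (simp add: algebra_simps)
    qed
    \<comment> \<open>Polarisation: the square of \<open>w\<close> gives the damping, that of
      \<open>z\<close> has a favourable sign and is dropped, and that of \<open>z - w\<close> is
      controlled by the gradient.\<close>
    moreover have "- (bump R y * (p * Re (z * cnj w))) \<le> \<beta> / 2 * (cmod (z - w))\<^sup>2 - \<alpha> / 2 * (bump R y * (cmod w)\<^sup>2)"
    proof -
      have polar: "Re (z * cnj w) = ((cmod z)\<^sup>2 + (cmod w)\<^sup>2 - (cmod (z - w))\<^sup>2) / 2"
        by (simp add: cmod_power2 power2_diff)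
      have p: "\<alpha> \<le> p" "p \<le> \<beta>" "0 \<le> p"
        using V[of y] \<alpha> unfolding p_def by auto
      have "bump R y * (\<alpha> / 2 * (cmod w)\<^sup>2) \<le> bump R y * (p / 2 * (cmod w)\<^sup>2)"
        using p by (intro mult_left_mono mult_right_mono bump_nonneg) auto
      moreover have "bump R y * (p / 2 * (cmod (z - w))\<^sup>2) \<le> 1 * (\<beta> / 2 * (cmod (z - w))\<^sup>2)"
        using p bump_le_one[OF y R] by (intro mult_mono) auto
      moreover have "0 \<le> bump R y * (p / 2 * (cmod z)\<^sup>2)"
        using p by (simp add: bump_nonneg)
      moreover have "bump R y * (p * Re (z * cnj w)) = bump R y * (p / 2 * (cmod z)\<^sup>2)
          + bump R y * (p / 2 * (cmod w)\<^sup>2) - bump R y * (p / 2 * (cmod (z - w))\<^sup>2)"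
        unfolding polar by (simp add: field_simps)
      ultimately show ?thesis
        unfolding mult.left_commute[of "\<alpha> / 2"] by linarith
    qed
    moreover have "s *\<^sub>R (Im \<circ> ?F) y = \<nu> * (bump'' R y * i)
        + - (\<nu> * (2 * bump R y * i')) + - (bump R y * (p * Re (z * cnj w)))"
      unfolding local_flux_def i_def i'_def zw p_def by (simp add: algebra_simps)
    moreover have "\<nu> * (8 / R\<^sup>2 * (((cmod z)\<^sup>2 + (cmod w)\<^sup>2) / 2))
        = 4 * \<nu> / R\<^sup>2 * (cmod w)\<^sup>2 + 4 * \<nu> / R\<^sup>2 * (cmod z)\<^sup>2"
      by (simp add: algebra_simps add_divide_distrib)
    ultimately show "s *\<^sub>R (Im \<circ> ?F) y \<le> ?J y"
      unfolding zw distrib_left[of \<nu>] by linarith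
  qed
  also have "\<dots> = 4 * \<nu> / R\<^sup>2 * integral {-R..R} ?f + 4 * \<nu> / R\<^sup>2 * integral {-R..R} ?g
      + \<nu> * integral {-R..R} ?f' + \<nu> * integral {-R..R} ?g'
      + \<beta> / 2 * integral {-R..R} ?e - \<alpha> / 2 * energy R t"
  proof -
    have int: "?f integrable_on {-R..R}" "?g integrable_on {-R..R}" "?f' integrable_on {-R..R}"
      "?g' integrable_on {-R..R}" "?e integrable_on {-R..R}" "(\<lambda>y. bump R y * ?f y) integrable_on {-R..R}"
      by (intro integrable_continuous_interval continuous_intros c)+
    show ?thesis
      unfolding energy_eq[OF t]
      by (rule integral_unique)
        (intro has_integral_add has_integral_diff has_integral_mult_right integrable_integral int)
  qed
  also have "\<dots> \<le> 8 * \<nu> * B\<^sup>2 / R\<^sup>2 - \<alpha> / 2 * energy R t + (2 * \<nu> + \<beta> / 2 * h\<^sup>2) * W"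
  proof -
    have B: "(L2_norm (f t))\<^sup>2 \<le> B\<^sup>2"
      by (rule L2_square_bound[OF t])
    have "4 * \<nu> / R\<^sup>2 * integral {-R..R} ?f \<le> 4 * \<nu> / R\<^sup>2 * B\<^sup>2"
      using \<nu>_pos order_trans[OF integral_square_le_L2_norm[OF square_int[OF t]] B]
      by (intro mult_left_mono) auto
    moreover have "4 * \<nu> / R\<^sup>2 * integral {-R..R} ?g \<le> 4 * \<nu> / R\<^sup>2 * B\<^sup>2"
      using \<nu>_pos order_trans[OF integral_shifted_square_le_L2_norm[OF square_int[OF t]] B]
      by (intro mult_left_mono) auto
    moreover have "\<nu> * integral {-R..R} ?f' \<le> \<nu> * W"
      unfolding W_def using \<nu>_pos h
      by (intro mult_left_mono integral_subset_le integrable_continuous_interval continuous_intros c) auto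
    moreover have "\<nu> * integral {-R..R} ?g' \<le> \<nu> * W"
    proof -
      \<comment> \<open>The translate reaches up to \<open>R + h\<close>, hence the enlarged window
        in \<open>W\<close>.\<close>
      have "integral {-R..R} ?g' = integral {-R + h..R + h} ?f'"
        using integral_shift_Icc_real[of "-R" R ?f' h] by (simp add: o_def add.commute)
      also have "\<dots> \<le> W"
        unfolding W_def using h
        by (intro integral_subset_le integrable_continuous_interval continuous_intros c) auto
      finally show ?thesis using \<nu>_pos by simp
    qed
    moreover have "\<beta> / 2 * integral {-R..R} ?e \<le> \<beta> / 2 * (h\<^sup>2 * W)"
      unfolding W_def using h R \<beta> integral_difference_square_le[OF _ _ deriv_y[OF t] c(3)]
      by (intro mult_left_mono) auto
    ultimately show ?thesis
      by (simp add: algebra_simps)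
  qed
  finally show ?thesis unfolding W_def .
qed

text \<open>At the doubled scale the cutoff is at least 1/2 on \<open>{-R..R}\<close>, so half of
  the factor \<open>2 * \<nu>\<close> survives without a cutoff, in the form needed to absorb the
  gradient from the cross term.\<close>

lemma energy_rate_le_gradient:
  assumes R: "0 < R" and t: "t \<in> {a..b}"
  shows "energy_rate (2 * R) t
    \<le> 2 * \<nu> * B\<^sup>2 / R\<^sup>2 - \<nu> * integral {-R..R} (\<lambda>y. (cmod (fy t y))\<^sup>2)"
proof -
  note c = cont_slice[OF t]
  have "1 / 2 * integral {-R..R} (\<lambda>y. (cmod (fy t y))\<^sup>2) = integral {-R..R} (\<lambda>y. 1 / 2 * (cmod (fy t y))\<^sup>2)"
    by simp
  also have "\<dots> \<le> integral {-R..R} (\<lambda>y. bump (2 * R) y * (cmod (fy t y))\<^sup>2)"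
    using R by (intro integral_le integrable_continuous_interval continuous_intros c mult_right_mono
        bump_ge_half) auto
  also have "\<dots> \<le> integral {-(2 * R)..2 * R} (\<lambda>y. bump (2 * R) y * (cmod (fy t y))\<^sup>2)"
    using R by (intro integral_subset_le integrable_continuous_interval continuous_intros c)
      (auto simp: bump_nonneg)
  finally have "2 * \<nu> * (1 / 2 * integral {-R..R} (\<lambda>y. (cmod (fy t y))\<^sup>2))
    \<le> 2 * \<nu> * integral {-(2 * R)..2 * R} (\<lambda>y. bump (2 * R) y * (cmod (fy t y))\<^sup>2)"
    using \<nu>_pos by (intro mult_left_mono) auto
  moreover have "8 * \<nu> * B\<^sup>2 / (2 * R)\<^sup>2 = 2 * \<nu> * B\<^sup>2 / R\<^sup>2"
    by (simp add: power_mult_distrib)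
  ultimately show ?thesis
    using energy_rate_le[of "2 * R" t] R t by simp
qed

text \<open>Monotonicity of \<open>s Q + K E\<close>, where \<open>Q\<close> is the cross term at scale \<open>R\<close> and \<open>E\<close> the energy at
  the larger scale \<open>2 (R + h)\<close>, whose cutoff is at least \<open>1/2\<close> wherever the gradient has to be absorbed.\<close>

lemma mixing_estimate:
  assumes ab: "a \<le> b" and h: "0 < h" and \<alpha>: "0 \<le> \<alpha>" and s: "s \<in> {1, -1}"
    and V: "\<And>t y. t \<in> {a..b} \<Longrightarrow> \<alpha> \<le> s * (\<kappa> * (V t (y + h) - V t y))"
      "\<And>t y. t \<in> {a..b} \<Longrightarrow> s * (\<kappa> * (V t (y + h) - V t y)) \<le> \<beta>"
  shows "(b - a) * \<alpha> / 2 * (L2_norm (f b))\<^sup>2 \<le> (4 + \<beta> * h\<^sup>2 / (2 * \<nu>)) * (L2_norm (f a))\<^sup>2"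
proof -
  \<comment> \<open>Chosen so that \<open>K * \<nu>\<close> is exactly the gradient coefficient in
    the cross rate; adding \<open>K\<close> times the energy cancels it.\<close>
  define K where "K = 2 + \<beta> * h\<^sup>2 / (2 * \<nu>)"
  define N where "N = (L2_norm (f a))\<^sup>2"
  have mem: "a \<in> {a..b}" "b \<in> {a..b}" using ab by auto
  have "0 \<le> \<beta>" using V[OF mem(1), of 0] \<alpha> by linarith
  then have K: "0 \<le> K" and K\<nu>: "2 * \<nu> + \<beta> / 2 * h\<^sup>2 = K * \<nu>"
    using \<nu>_pos unfolding K_def by (auto simp: field_simps)
  \<comment> \<open>All cutoff errors together: from comparing energies at times \<open>t\<close>
    and \<open>b\<close>, from the cross rate, and from the energy rate.\<close>
  define D where "D = (b - a) * (\<alpha> / 2 * (8 * (b - a)) + 8 + K * 2) * (\<nu> * B\<^sup>2)"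
  have local: "(b - a) * \<alpha> / 2 * energy R b \<le> (2 + K) * N + D / R\<^sup>2" if R: "0 < R" for R
  proof -
    define Q where "Q t = Im (local_inner R (\<lambda>y. f t (y + h)) (f t))" for t
    \<comment> \<open>A time-independent bound on the rate: the energy at time \<open>t\<close> is
      replaced from below by that at the final time \<open>b\<close>, up to a cutoff error.\<close>
    define L where "L = 8 * \<nu> * B\<^sup>2 / R\<^sup>2 + K * (2 * \<nu> * B\<^sup>2 / R\<^sup>2)
      - \<alpha> / 2 * (energy R b - 8 * \<nu> * B\<^sup>2 / R\<^sup>2 * (b - a))"
    have Rh: "0 < R + h" "0 < 2 * (R + h)" using R h by auto
    have "s * Q b + K * energy (2 * (R + h)) b \<le> s * Q a + K * energy (2 * (R + h)) a + L * (b - a)"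
    proof (rule decrease_if_derivative_le[OF ab])
      fix t assume t: "t \<in> {a..b}"
      show "((\<lambda>t. s * Q t + K * energy (2 * (R + h)) t) has_vector_derivative
          s * cross_rate h R t + K * energy_rate (2 * (R + h)) t) (at t within {a..b})"
        unfolding Q_def
        by (intro has_vector_derivative_add has_vector_derivative_mult_right
            cross_has_vector_derivative energy_has_vector_derivative R Rh t)
      define W where "W = integral {-(R + h)..R + h} (\<lambda>y. (cmod (fy t y))\<^sup>2)"
      have "s * cross_rate h R t \<le> 8 * \<nu> * B\<^sup>2 / R\<^sup>2 - \<alpha> / 2 * energy R t + K * (\<nu> * W)"
        unfolding W_def mult.assoc[symmetric, of K] K\<nu>[symmetric] by (rule cross_rate_le[OF R t h \<alpha> s V[OF t]])
      moreover have "K * energy_rate (2 * (R + h)) t \<le> K * (2 * \<nu> * B\<^sup>2 / R\<^sup>2 - \<nu> * W)"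
      proof (rule mult_left_mono[OF _ K])
        have "2 * \<nu> * B\<^sup>2 / (R + h)\<^sup>2 \<le> 2 * \<nu> * B\<^sup>2 / R\<^sup>2"
          using R h \<nu>_pos by (intro divide_left_mono power_mono) auto
        then show "energy_rate (2 * (R + h)) t \<le> 2 * \<nu> * B\<^sup>2 / R\<^sup>2 - \<nu> * W"
          using energy_rate_le_gradient[OF Rh(1) t] unfolding W_def by linarith
      qed
      moreover have "\<alpha> / 2 * (energy R b - 8 * \<nu> * B\<^sup>2 / R\<^sup>2 * (b - a)) \<le> \<alpha> / 2 * energy R t"
      proof (rule mult_left_mono)
        have "8 * \<nu> * B\<^sup>2 / R\<^sup>2 * (b - t) \<le> 8 * \<nu> * B\<^sup>2 / R\<^sup>2 * (b - a)"
          using t \<nu>_pos by (intro mult_left_mono) auto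
        then show "energy R b - 8 * \<nu> * B\<^sup>2 / R\<^sup>2 * (b - a) \<le> energy R t"
          using energy_almost_decreasing[OF R t mem(2)] t by auto
      qed (use \<alpha> in simp)
      ultimately show "s * cross_rate h R t + K * energy_rate (2 * (R + h)) t \<le> L"
        unfolding L_def right_diff_distrib[of K] by linarith
    qed
    moreover have Q: "\<bar>s * Q t\<bar> \<le> N" if t: "t \<in> {a..b}" for t
    proof -
      have "\<bar>s * Q t\<bar> \<le> cmod (local_inner R (\<lambda>y. f t (y + h)) (f t))"
        using s abs_Im_le_cmod unfolding Q_def by auto
      also have "\<dots> \<le> (L2_norm (f t))\<^sup>2"
        by (intro cmod_local_inner_shift_le R cont_slice square_int t)
      also have "\<dots> \<le> N"
        unfolding N_def using t mem by (intro L2_norm_square_decreasing) auto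
      finally show ?thesis .
    qed
    moreover have "0 \<le> K * energy (2 * (R + h)) b"
      using K unfolding energy_def by (intro mult_nonneg_nonneg Re_local_inner_self_nonneg cont_slice mem)
    moreover have "K * energy (2 * (R + h)) a \<le> K * N"
      unfolding N_def by (intro mult_left_mono energy_le_L2 Rh mem K)
    \<comment> \<open>The cross terms at the two ends cost \<open>N\<close> each, the initial energy
      costs \<open>K * N\<close>, and the final energy is dropped.\<close>
    ultimately have "- (L * (b - a)) \<le> 2 * N + K * N"
      using Q[OF mem(1)] Q[OF mem(2)] unfolding abs_le_iff by linarith
    moreover have "- (L * (b - a)) = (b - a) * \<alpha> / 2 * energy R b - D / R\<^sup>2"
    proof -
      define Z A where "Z = \<nu> * B\<^sup>2 / R\<^sup>2" and "A = \<alpha> / 2"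
      have L: "L = 8 * Z + K * (2 * Z) - A * (energy R b - 8 * Z * (b - a))"
        and D: "D / R\<^sup>2 = (b - a) * (A * (8 * (b - a)) + 8 + K * 2) * Z"
        and A: "(b - a) * \<alpha> / 2 = (b - a) * A"
        unfolding L_def D_def Z_def A_def by (simp_all add: mult.assoc)
      show ?thesis
        unfolding L D A by (simp add: algebra_simps)
    qed
    ultimately show ?thesis by (simp add: algebra_simps)
  qed
  have "(b - a) * \<alpha> / 2 * (L2_norm (f b))\<^sup>2 \<le> (2 + K) * N"
  proof (cases "(b - a) * \<alpha> = 0")
    case True
    moreover have "0 \<le> (2 + K) * N"
      using K unfolding N_def by (intro mult_nonneg_nonneg) auto
    ultimately show ?thesis by auto
  next
    case False
    \<comment> \<open>Dividing by the positive \<open>A\<close> isolates the localised energy, so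
      that \<open>R\<close> can tend to infinity.\<close>
    define A where "A = (b - a) * \<alpha> / 2"
    have A: "0 < A" using False ab \<alpha> unfolding A_def by (simp add: less_le)
    have "(L2_norm (f b))\<^sup>2 \<le> (2 + K) * N / A"
    proof (rule L2_norm_square_le_if_local[OF square_int[OF mem(2)]])
      fix R :: real assume "0 < R"
      from local[OF this] show "integral {-R..R} (\<lambda>y. bump R y * (cmod (f b y))\<^sup>2) \<le> (2 + K) * N / A + D / A / R\<^sup>2"
        using A unfolding A_def[symmetric] energy_eq[OF mem(2), symmetric] by (simp add: field_simps)
    qed
    then show ?thesis
      using A unfolding A_def[symmetric] by (simp add: pos_le_divide_eq mult.commute)
  qed
  moreover have "2 + K = 4 + \<beta> * h\<^sup>2 / (2 * \<nu>)"
    unfolding K_def by simp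
  ultimately show ?thesis
    unfolding N_def by simp
qed

end

subsection \<open>Exponential decay\<close>

lemma square_integrable_scaleR:
  assumes "square_integrable u"
  shows "square_integrable (\<lambda>y. r *\<^sub>R u y)"
  using assms unfolding square_integrable_def by (auto simp: power_mult_distrib)

lemma L2_norm_scaleR: "L2_norm (\<lambda>y. r *\<^sub>R u y) = \<bar>r\<bar> * L2_norm u"
  unfolding L2_norm_def by (simp add: power_mult_distrib real_sqrt_mult)

text \<open>Contraction is available only from positive times, so whole steps are taken backwards
  from \<open>t\<close>. The remaining partial step uses monotonicity and costs the factor
  \<open>exp 1\<close>.\<close>

lemma exponential_decay_if_contraction:
  fixes N :: "real \<Rightarrow> real"
  assumes \<tau>: "0 < \<tau>" and nonneg: "\<And>t. 0 \<le> N t"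
    and mono: "\<And>s t. 0 \<le> s \<Longrightarrow> s \<le> t \<Longrightarrow> t \<le> T \<Longrightarrow> N t \<le> N s"
    and contraction: "\<And>s. 0 < s \<Longrightarrow> s + \<tau> \<le> T \<Longrightarrow> N (s + \<tau>) \<le> exp (- 1) * N s"
    and t: "t \<in> {0..T}"
  shows "N t \<le> exp 1 * N 0 * exp (- (t / \<tau>))"
proof (cases "t = 0")
  case True
  have "1 * N 0 \<le> exp 1 * N 0"
    by (intro mult_right_mono nonneg) simp
  then show ?thesis using True by simp
next
  case False
  then have t: "0 < t" "t \<le> T" using t by auto
  have iterate: "N t \<le> exp (- real n) * N (t - real n * \<tau>)" if "0 < t - real n * \<tau>" for n
    using that
  proof (induction n)
    case (Suc n)
    let ?s = "t - real (Suc n) * \<tau>"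
    have s: "?s + \<tau> = t - real n * \<tau>"
      by (simp add: algebra_simps)
    have "0 \<le> real n * \<tau>" using \<tau> by simp
    then have "?s + \<tau> \<le> T" using t unfolding s by linarith
    from contraction[OF Suc.prems this] have "N (t - real n * \<tau>) \<le> exp (- 1) * N ?s"
      unfolding s .
    then have "exp (- real n) * N (t - real n * \<tau>) \<le> exp (- real n) * (exp (- 1) * N ?s)"
      by (intro mult_left_mono) auto
    also have "\<dots> = exp (- real (Suc n)) * N ?s"
      by (simp add: mult_exp_exp mult.assoc[symmetric])
    finally show ?case
      using Suc.IH Suc.prems \<tau> s by linarith
  qed simp
  \<comment> \<open>The largest number of steps leaving a strictly positive time; a floor would
    reach time 0 whenever \<open>t / \<tau>\<close> is an integer.\<close>
  define n where "n = nat (\<lceil>t / \<tau>\<rceil> - 1)"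
  have pos: "0 < t / \<tau>" using t \<tau> by simp
  then have n: "real n = of_int \<lceil>t / \<tau>\<rceil> - 1"
    unfolding n_def by (simp add: of_nat_nat)
  then have n': "real n < t / \<tau>" "t / \<tau> \<le> real n + 1"
    by linarith+
  then have s: "0 < t - real n * \<tau>"
    using \<tau> by (simp add: field_simps)
  have "N t \<le> exp (- real n) * N (t - real n * \<tau>)"
    by (rule iterate[OF s])
  also have "\<dots> \<le> exp (1 - t / \<tau>) * N 0"
  proof (intro mult_mono)
    have "0 \<le> real n * \<tau>" using \<tau> by simp
    then show "N (t - real n * \<tau>) \<le> N 0"
      using s t by (intro mono) auto
  qed (use n' nonneg in auto)
  also have "exp (1 - t / \<tau>) = exp 1 * exp (- (t / \<tau>))"
    by (simp add: mult_exp_exp)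
  finally show ?thesis by (simp add: mult_ac)
qed

text \<open>The factor \<open>exp (\<sigma> \<nu> k\<^sup>2 t)\<close> removes the damping term, so that only \<open>\<sigma> = 0\<close> has to be treated.\<close>

definition undamped :: "real \<Rightarrow> (real \<Rightarrow> real \<Rightarrow> complex) \<Rightarrow> real \<Rightarrow> real \<Rightarrow> complex" where
  "undamped \<mu> f t y = exp (\<mu> * t) *\<^sub>R f t y"

lemma Ct_C2y_D:
  assumes "Ct_C2y T V" "t \<in> {0..T}"
  shows "continuous_on UNIV (V t)" "(V t has_real_derivative deriv (V t) y) (at y)"
  using assms unfolding Ct_C2y_def
  by (blast intro: field_differentiable_derivI continuous_at_imp_continuous_on field_differentiable_imp_continuous_at)+

section \<open>The mode and its undamped version\<close>

locale shear_mode =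
  fixes T \<nu> \<sigma> :: real and k :: int and V :: "real \<Rightarrow> real \<Rightarrow> real" and g :: "real \<Rightarrow> complex"
    and f :: "real \<Rightarrow> real \<Rightarrow> complex"
  assumes V: "Ct_C2y T V" and \<nu>_pos: "0 < \<nu>" and \<sigma>_nonneg: "0 \<le> \<sigma>"
    and sol: "mode_solution T \<nu> \<sigma> k V g f"
begin

definition \<mu> :: real where
  "\<mu> = \<sigma> * \<nu> * (of_int \<bar>k\<bar>)\<^sup>2"

abbreviation F :: "real \<Rightarrow> real \<Rightarrow> complex" where
  "F \<equiv> undamped \<mu> f"

lemma \<mu>_nonneg: "0 \<le> \<mu>"
  unfolding \<mu>_def using \<nu>_pos \<sigma>_nonneg by simp

lemma cont_F: "continuous_on ({0..T} \<times> UNIV) (\<lambda>(t, y). F t y)"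
  using sol unfolding mode_solution_def undamped_def case_prod_unfold
  by (auto intro!: continuous_intros)

lemma square_integrable_F: "t \<in> {0..T} \<Longrightarrow> square_integrable (F t)"
  using sol unfolding mode_solution_def undamped_def by (blast intro: square_integrable_scaleR)

lemma L2_norm_F: "L2_norm (F t) = exp (\<mu> * t) * L2_norm (f t)"
  unfolding undamped_def by (simp add: L2_norm_scaleR)

lemma F_0: "F 0 = g"
  using sol unfolding mode_solution_def undamped_def by auto

text \<open>The derivative of the exponential factor cancels the damping term. Derivatives exist
  only for positive times, hence \<open>0 < a\<close>; one choice of them and of \<open>B\<close>
  serves all windows.\<close>

lemma bounded_advection_diffusion_F:
  obtains ft fy fyy B where
    "\<And>a b. 0 < a \<Longrightarrow> b \<le> T \<Longrightarrow> bounded_advection_diffusion a b \<nu> (of_int k) V F ft fy fyy B"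
proof -
  from sol obtain B ft fy fyy where cf: "continuous_on ({0..T} \<times> UNIV) (\<lambda>(t, y). f t y)"
    and B: "\<And>t. t \<in> {0..T} \<Longrightarrow> L2_norm (f t) \<le> B"
    and cont: "continuous_on ({0<..T} \<times> UNIV) (\<lambda>(t, y). ft t y)"
      "continuous_on ({0<..T} \<times> UNIV) (\<lambda>(t, y). fy t y)"
      "continuous_on ({0<..T} \<times> UNIV) (\<lambda>(t, y). fyy t y)"
    and dt: "\<And>t y. t \<in> {0<..T} \<Longrightarrow> ((\<lambda>s. f s y) has_vector_derivative ft t y) (at t within {0..T})"
    and dy: "\<And>t y. t \<in> {0<..T} \<Longrightarrow> (f t has_vector_derivative fy t y) (at y)"
    and dyy: "\<And>t y. t \<in> {0<..T} \<Longrightarrow> (fy t has_vector_derivative fyy t y) (at y)"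
    and eq: "\<And>t y. t \<in> {0<..T} \<Longrightarrow> ft t y + \<i> * of_int k * of_real (V t y) * f t y =
             of_real \<nu> * fyy t y - of_real (\<sigma> * \<nu> * (of_int \<bar>k\<bar>)\<^sup>2) * f t y"
    unfolding mode_solution_def by blast
  define ft' where "ft' t y = exp (\<mu> * t) *\<^sub>R (ft t y + \<mu> *\<^sub>R f t y)" for t y
  define B' where "B' = exp (\<mu> * T) * \<bar>B\<bar>"
  have "bounded_advection_diffusion a b \<nu> (of_int k) V F ft' (undamped \<mu> fy) (undamped \<mu> fyy) B'"
    if ab: "0 < a" "b \<le> T" for a b
  proof
    have sub: "{a..b} \<subseteq> {0<..T}" "{a..b} \<subseteq> {0..T}" using ab by auto
    have cont': "continuous_on ({a..b} \<times> UNIV) (\<lambda>p. f (fst p) (snd p))"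
      "continuous_on ({a..b} \<times> UNIV) (\<lambda>p. ft (fst p) (snd p))"
      "continuous_on ({a..b} \<times> UNIV) (\<lambda>p. fy (fst p) (snd p))"
      "continuous_on ({a..b} \<times> UNIV) (\<lambda>p. fyy (fst p) (snd p))"
      using cf cont sub by (auto simp: case_prod_unfold elim!: continuous_on_subset)
    show "continuous_on ({a..b} \<times> UNIV) (\<lambda>(t, y). F t y)"
      "continuous_on ({a..b} \<times> UNIV) (\<lambda>(t, y). ft' t y)"
      "continuous_on ({a..b} \<times> UNIV) (\<lambda>(t, y). undamped \<mu> fy t y)"
      "continuous_on ({a..b} \<times> UNIV) (\<lambda>(t, y). undamped \<mu> fyy t y)"
      unfolding undamped_def ft'_def case_prod_unfold by (intro continuous_intros cont')+
    show "0 < \<nu>" by (rule \<nu>_pos)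
    fix t assume "t \<in> {a..b}"
    then have t: "t \<in> {0<..T}" "t \<in> {0..T}" using sub by auto
    show "continuous_on UNIV (V t)"
      by (rule Ct_C2y_D[OF V t(2)])
    show "square_integrable (F t)"
      by (rule square_integrable_F[OF t(2)])
    show "L2_norm (F t) \<le> B'"
      unfolding L2_norm_F B'_def using B[OF t(2)] t(2) \<mu>_nonneg
      by (intro mult_mono) (auto intro: mult_left_mono L2_norm_nonneg)
    fix y
    show "(F t has_vector_derivative undamped \<mu> fy t y) (at y)"
      unfolding undamped_def[abs_def]
      by (rule derivative_eq_intros dy[OF t(1)] refl | simp)+
    show "(undamped \<mu> fy t has_vector_derivative undamped \<mu> fyy t y) (at y)"
      unfolding undamped_def[abs_def]
      by (rule derivative_eq_intros dyy[OF t(1)] refl | simp)+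
    have "((\<lambda>s. f s y) has_vector_derivative ft t y) (at t within {a..b})"
      by (rule has_vector_derivative_within_subset[OF dt[OF t(1)] sub(2)])
    then show "((\<lambda>s. F s y) has_vector_derivative ft' t y) (at t within {a..b})"
      unfolding undamped_def ft'_def
      by (auto intro!: derivative_eq_intros simp: algebra_simps)
    have eq': "ft t y + \<mu> *\<^sub>R f t y = of_real \<nu> * fyy t y - \<i> * of_real (of_int k * V t y) * f t y"
      using eq[OF t(1), of y] unfolding \<mu>_def by (simp add: scaleR_conv_of_real algebra_simps)
    show "ft' t y = of_real \<nu> * undamped \<mu> fyy t y - \<i> * of_real (of_int k * V t y) * F t y"
      unfolding ft'_def undamped_def eq' by (simp add: scaleR_conv_of_real algebra_simps)
  qed
  then show ?thesis by (rule that)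
qed

text \<open>From time 0 the equation cannot be used directly. Joint continuity makes the localised
  energy continuous down to time 0, so the estimate passes there first at fixed \<open>R\<close>,
  and then \<open>R\<close> tends to infinity.\<close>

lemma L2_norm_F_decreasing:
  assumes st: "0 \<le> s" "s \<le> t" "t \<le> T"
  shows "L2_norm (F t) \<le> L2_norm (F s)"
proof -
  obtain ft fy fyy B where adv:
    "\<And>a b. 0 < a \<Longrightarrow> b \<le> T \<Longrightarrow> bounded_advection_diffusion a b \<nu> (of_int k) V F ft fy fyy B"
    using bounded_advection_diffusion_F by blast
  have "(L2_norm (F t))\<^sup>2 \<le> (L2_norm (F s))\<^sup>2"
  proof (cases "0 < s \<or> s = t")
    case True
    then show ?thesis
      using bounded_advection_diffusion.L2_norm_square_decreasing[OF adv[of s t], of s t] st by auto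
  next
    case False
    then have s: "s = 0" "0 < t" using st by auto
    show ?thesis unfolding s
    proof (rule L2_norm_square_le_if_local[OF square_integrable_F])
      show "t \<in> {0..T}" using st by simp
      fix R :: real assume R: "0 < R"
      define E where "E s = integral {-R..R} (\<lambda>y. bump R y * (cmod (F s y))\<^sup>2)" for s
      have local: "E t \<le> E r + 8 * \<nu> * B\<^sup>2 / R\<^sup>2 * (t - r)" if r: "r \<in> {0<..<t}" for r
      proof -
        interpret bounded_advection_diffusion r t \<nu> "of_int k" V F ft fy fyy B
          using r st by (intro adv) auto
        show ?thesis
          using energy_almost_decreasing[OF R, of r t] r unfolding E_def by (simp add: energy_eq)
      qed
      have cF: "continuous_on ({0..t} \<times> cbox (-R) R) (\<lambda>p. F (fst p) (snd p))"
      proof -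
        have "{0..t} \<times> cbox (-R) R \<subseteq> {0..T} \<times> UNIV"
          using st by auto
        from continuous_on_subset[OF cont_F this] show ?thesis
          by (simp add: case_prod_unfold)
      qed
      have cb: "continuous_on ({0..t} \<times> cbox (-R) R) (\<lambda>p. bump R (snd p))"
        by (rule continuous_on_compose2[OF continuous_on_bump(1)[of UNIV]]) (auto intro: continuous_intros)
      have "continuous_on {0..t} (\<lambda>s. integral (cbox (-R) R) (\<lambda>y. bump R y * (cmod (F s y))\<^sup>2))"
        by (rule integral_continuous_on_param) (unfold case_prod_unfold, intro continuous_intros cF cb)
      then have cE: "continuous_on {0..t} E"
        unfolding E_def by simp
      have cl: "closure {0<..<t} = {0..t}"
        using s by (simp add: closure_greaterThanLessThan)
      have "E t \<le> E 0 + 8 * \<nu> * B\<^sup>2 / R\<^sup>2 * (t - 0)"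
        by (rule continuous_ge_on_closure[of "{0<..<t}" "\<lambda>r. E r + 8 * \<nu> * B\<^sup>2 / R\<^sup>2 * (t - r)"])
          (use local s R in \<open>auto simp: cl intro!: continuous_intros cE\<close>)
      also have "E 0 \<le> (L2_norm (F 0))\<^sup>2"
      proof -
        have "continuous_on {-R..R} (F 0)"
          using st by (intro continuous_on_slice_snd[OF cont_F]) auto
        then show ?thesis
          unfolding E_def using st R Re_local_inner_self_le[OF R _ square_integrable_F, of 0]
          by (simp add: Re_local_inner_self)
      qed
      finally show "E t \<le> (L2_norm (F 0))\<^sup>2 + 8 * \<nu> * B\<^sup>2 * t / R\<^sup>2"
        by simp
    qed
  qed
  then show ?thesis
    by (rule power2_le_imp_le) (rule L2_norm_nonneg)
qed

text \<open>The mixing estimate with \<open>\<alpha> = l * c\<close> and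
  \<open>\<beta> = l * M\<close> bounds \<open>c * l * \<tau>\<close> times the final squared norm
  by \<open>8 + M\<close> times the initial one; the condition on \<open>\<tau>\<close> turns this
  into a factor \<open>exp 2\<close>.\<close>

lemma L2_norm_F_contraction:
  assumes c: "0 < c" "\<And>t y. t \<in> {0..T} \<Longrightarrow> c \<le> \<bar>deriv (V t) y\<bar>"
    and M: "\<And>t y. t \<in> {0..T} \<Longrightarrow> \<bar>deriv (V t) y\<bar> \<le> M"
    and k: "k \<noteq> 0" and \<tau>: "0 < \<tau>" "exp 2 * (8 + M) \<le> c * (\<nu> powr (1/3) * \<bar>of_int k\<bar> powr (2/3) * \<tau>)"
    and s: "0 < s" "s + \<tau> \<le> T"
  shows "L2_norm (F (s + \<tau>)) \<le> exp (- 1) * L2_norm (F s)"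
proof -
  obtain ft fy fyy B where adv: "bounded_advection_diffusion s (s + \<tau>) \<nu> (of_int k) V F ft fy fyy B"
    using bounded_advection_diffusion_F s by metis
  interpret bounded_advection_diffusion s "s + \<tau>" \<nu> "of_int k" V F ft fy fyy B
    by (rule adv)
  define q :: real where "q = \<bar>of_int k\<bar>"
  have q: "0 < q" using k unfolding q_def by simp
  \<comment> \<open>The scale balancing transport and diffusion: \<open>q * h = l\<close> is the
    decay rate and \<open>l * h\<^sup>2 = \<nu>\<close>.\<close>
  define h where "h = \<nu> powr (1/3) * q powr (- 1/3)"
  define l where "l = \<nu> powr (1/3) * q powr (2/3)"
  have h: "0 < h" using q \<nu>_pos unfolding h_def by simp
  have qh: "q * h = l"
  proof -
    have "q * q powr (- 1/3) = q powr (1 + - 1/3)"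
      using q by (subst powr_add) simp
    then show ?thesis unfolding h_def l_def by (simp add: mult.left_commute)
  qed
  have lh: "l * h\<^sup>2 = \<nu>"
  proof -
    have "l * h\<^sup>2 = (\<nu> powr (1/3) * \<nu> powr (1/3) * \<nu> powr (1/3)) * (q powr (2/3) * q powr (- 1/3) * q powr (- 1/3))"
      unfolding h_def l_def power2_eq_square by (simp only: mult_ac)
    also have "\<dots> = \<nu>"
      unfolding powr_add[symmetric] using q \<nu>_pos by simp
    finally show ?thesis .
  qed
  have "connected ({0..T} \<times> (UNIV :: real set))"
    by (intro connected_Times connected_UNIV) simp
  then obtain s0 where s0: "s0 \<in> {1, -1}"
    and "\<And>p. p \<in> {0..T} \<times> UNIV \<Longrightarrow> \<bar>case p of (t, y) \<Rightarrow> deriv (V t) y\<bar> = s0 * (case p of (t, y) \<Rightarrow> deriv (V t) y)"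
    by (rule constant_sign_if_bounded_away[OF _ Ct_C2y_continuous_deriv[OF V] c(1)]) (use c(2) in auto)
  then have s0': "s0 * deriv (V t) y = \<bar>deriv (V t) y\<bar>" if "t \<in> {0..T}" for t y
    using that by force
  \<comment> \<open>By the mean value theorem; the sign of the shear times the sign of
    \<open>k\<close> makes the expression positive.\<close>
  have shear: "l * c \<le> s0 * sgn (of_int k) * (of_int k * (V t (y + h) - V t y)) \<and>
      s0 * sgn (of_int k) * (of_int k * (V t (y + h) - V t y)) \<le> l * M" if "t \<in> {s..s + \<tau>}" for t y
  proof -
    have t: "t \<in> {0..T}" using that s by auto
    obtain z where z: "V t (y + h) - V t y = (y + h - y) * deriv (V t) z"
      using MVT2[of y "y + h" "V t" "deriv (V t)"] h Ct_C2y_D(2)[OF V t] by auto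
    have "s0 * sgn (of_int k) * (of_int k * (V t (y + h) - V t y)) = (sgn (of_int k) * of_int k) * h * (s0 * deriv (V t) z)"
      unfolding z by (simp add: mult_ac)
    also have "sgn (of_int k) * of_int k = q"
      unfolding q_def by (simp add: abs_sgn mult.commute)
    finally have "s0 * sgn (of_int k) * (of_int k * (V t (y + h) - V t y)) = l * \<bar>deriv (V t) z\<bar>"
      unfolding qh s0'[OF t] .
    moreover have "0 < l" using q h qh by (metis mult_pos_pos)
    ultimately show ?thesis
      using c(2)[OF t, of z] M[OF t, of z] by simp
  qed
  have l: "0 < l" using q h qh by (metis mult_pos_pos)
  have M0: "0 \<le> M"
    using M[of s 0] s \<tau> abs_ge_zero[of "deriv (V s) 0"] by (simp del: abs_ge_zero)
  have mixing: "(s + \<tau> - s) * (l * c) / 2 * (L2_norm (F (s + \<tau>)))\<^sup>2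
      \<le> (4 + l * M * h\<^sup>2 / (2 * \<nu>)) * (L2_norm (F s))\<^sup>2"
  proof (rule mixing_estimate[where s = "s0 * sgn (of_int k)"])
    show "s0 * sgn (of_int k) \<in> {1, - 1 :: real}"
      using s0 k by (auto simp: sgn_if)
  qed (use shear h l c \<tau> in auto)
  have "l * M * h\<^sup>2 / (2 * \<nu>) = M / 2"
  proof -
    have "l * M * h\<^sup>2 = M * (l * h\<^sup>2)" by simp
    then have "l * M * h\<^sup>2 / (2 * \<nu>) = M * \<nu> / (2 * \<nu>)" by (simp only: lh)
    then show ?thesis using \<nu>_pos by simp
  qed
  from mixing[unfolded this] have "c * (l * \<tau>) * (L2_norm (F (s + \<tau>)))\<^sup>2 \<le> (8 + M) * (L2_norm (F s))\<^sup>2"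
    by (simp add: algebra_simps)
  moreover have "exp 2 * (8 + M) * (L2_norm (F (s + \<tau>)))\<^sup>2 \<le> c * (l * \<tau>) * (L2_norm (F (s + \<tau>)))\<^sup>2"
    using \<tau>(2) unfolding l_def q_def by (intro mult_right_mono) auto
  ultimately have "(8 + M) * (exp 2 * (L2_norm (F (s + \<tau>)))\<^sup>2) \<le> (8 + M) * (L2_norm (F s))\<^sup>2"
    by (simp add: mult_ac)
  then have "exp 2 * (L2_norm (F (s + \<tau>)))\<^sup>2 \<le> (L2_norm (F s))\<^sup>2"
    using M0 by simp
  moreover have "exp 2 = (exp 1 :: real)\<^sup>2"
    by (simp add: exp_double[symmetric])
  ultimately have "(exp 1 * L2_norm (F (s + \<tau>)))\<^sup>2 \<le> (L2_norm (F s))\<^sup>2"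
    by (simp add: power_mult_distrib)
  then have "exp 1 * L2_norm (F (s + \<tau>)) \<le> L2_norm (F s)"
    by (rule power2_le_imp_le) (rule L2_norm_nonneg)
  then have "exp (- 1) * (exp 1 * L2_norm (F (s + \<tau>))) \<le> exp (- 1) * L2_norm (F s)"
    by (rule mult_left_mono) simp
  then show ?thesis
    by (simp add: mult.assoc[symmetric] mult_exp_exp)
qed

end

section \<open>The decay estimate for all frequencies\<close>

theorem theorem1p1:
  shows "\<exists>\<delta> :: real \<Rightarrow> real \<Rightarrow> real.
    (\<forall>c M. 0 < c \<longrightarrow> 0 < \<delta> c M) \<and>
    (\<forall>(T::real) (V :: real \<Rightarrow> real \<Rightarrow> real) (c::real) (C::real).
       0 < T \<longrightarrow> Ct_C2y T V \<longrightarrow>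
       0 < c \<longrightarrow> c \<le> (INF (t, y) \<in> {0..T} \<times> UNIV. \<bar>deriv (V t) y\<bar>) \<longrightarrow>
       shear_norm T V < ereal C \<longrightarrow>
       (\<exists>\<nu>0>0. \<forall>(\<sigma>::real) (\<nu>::real) (k::int) (f0 :: real \<times> real \<Rightarrow> complex)
                 (f :: real \<Rightarrow> real \<Rightarrow> complex).
          \<sigma> \<in> {0, 1} \<longrightarrow> 0 < \<nu> \<longrightarrow> \<nu> < \<nu>0 \<longrightarrow>
          Cc_smooth_cylinder f0 \<longrightarrow>
          mode_solution T \<nu> \<sigma> k V (fourier_coeff_x k f0) f \<longrightarrow>
          (\<forall>t\<in>{0..T}.
             L2_norm (f t) \<le> exp 1 * L2_norm (fourier_coeff_x k f0) *
               exp (- (\<delta> c (real_of_ereal (shear_norm T V)) *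
                       \<nu> powr (1/3) * (of_int \<bar>k\<bar>) powr (2/3) * t)))))"
\<comment> \<open>This value makes the window \<open>1 / (d * l)\<close> meet the contraction
  condition with equality; the absolute value keeps it positive for every real
  \<open>M\<close>.\<close>
proof (intro exI[of _ "\<lambda>c M. c / (exp 2 * (8 + \<bar>M\<bar>))"] conjI allI impI)
  fix c M :: real
  assume "0 < c"
  then show "0 < c / (exp 2 * (8 + \<bar>M\<bar>))"
    by (intro divide_pos_pos mult_pos_pos) auto
next
  fix T c C :: real and V :: "real \<Rightarrow> real \<Rightarrow> real"
  assume T: "0 < T" and V: "Ct_C2y T V" and c: "0 < c"
    and inf: "c \<le> (INF (t, y) \<in> {0..T} \<times> UNIV. \<bar>deriv (V t) y\<bar>)" and C: "shear_norm T V < ereal C"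
  define M where "M = real_of_ereal (shear_norm T V)"
  note M = abs_deriv_le_shear_norm[OF T V C, folded M_def]
  have M0: "0 \<le> M"
    using M[of 0 0] T abs_ge_zero[of "deriv (V 0) 0"] by (simp del: abs_ge_zero)
  have c': "c \<le> \<bar>deriv (V t) y\<bar>" if "t \<in> {0..T}" for t y
  proof -
    have "(INF (t, y) \<in> {0..T} \<times> UNIV. \<bar>deriv (V t) y\<bar>) \<le> (\<lambda>(t, y). \<bar>deriv (V t) y\<bar>) (t, y)"
      using that by (intro cINF_lower bdd_belowI[of _ 0]) auto
    then show ?thesis using inf by simp
  qed
  define d where "d = c / (exp 2 * (8 + \<bar>M\<bar>))"
  have d: "0 < d"
    unfolding d_def using c by (intro divide_pos_pos mult_pos_pos) auto
  show "\<exists>\<nu>0>0. \<forall>(\<sigma>::real) (\<nu>::real) (k::int) (f0 :: real \<times> real \<Rightarrow> complex)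
                 (f :: real \<Rightarrow> real \<Rightarrow> complex).
          \<sigma> \<in> {0, 1} \<longrightarrow> 0 < \<nu> \<longrightarrow> \<nu> < \<nu>0 \<longrightarrow>
          Cc_smooth_cylinder f0 \<longrightarrow>
          mode_solution T \<nu> \<sigma> k V (fourier_coeff_x k f0) f \<longrightarrow>
          (\<forall>t\<in>{0..T}.
             L2_norm (f t) \<le> exp 1 * L2_norm (fourier_coeff_x k f0) *
               exp (- (c / (exp 2 * (8 + \<bar>real_of_ereal (shear_norm T V)\<bar>)) *
                       \<nu> powr (1/3) * (of_int \<bar>k\<bar>) powr (2/3) * t)))"
    unfolding M_def[symmetric] d_def[symmetric]
  proof (intro exI[of _ 1] conjI allI impI ballI)
    fix \<sigma> \<nu> :: real and k :: int and f0 :: "real \<times> real \<Rightarrow> complex"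
      and f :: "real \<Rightarrow> real \<Rightarrow> complex" and t :: real
    assume "\<sigma> \<in> {0, 1}" and \<nu>: "0 < \<nu>" and sol: "mode_solution T \<nu> \<sigma> k V (fourier_coeff_x k f0) f"
      and t: "t \<in> {0..T}"
    then interpret shear_mode T \<nu> \<sigma> k V "fourier_coeff_x k f0" f
      using V by unfold_locales auto
    define l where "l = \<nu> powr (1/3) * (of_int \<bar>k\<bar>) powr (2/3)"
    \<comment> \<open>The removed damping factor is at most 1, so a bound for \<open>F\<close>
      passes to \<open>f\<close>.\<close>
    have "L2_norm (f t) \<le> L2_norm (F t)"
      unfolding L2_norm_F using \<mu>_nonneg t mult_right_mono[OF _ L2_norm_nonneg, of 1 "exp (\<mu> * t)" "f t"]
      by simp
    also have "L2_norm (F t) \<le> exp 1 * L2_norm (F 0) * exp (- (d * l * t))"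
    proof (cases "k = 0")
      \<comment> \<open>Here \<open>0 powr (2/3) = 0\<close>, so the rate vanishes and monotonicity
        suffices.\<close>
      case True
      have "L2_norm (F t) \<le> 1 * L2_norm (F 0)"
        using L2_norm_F_decreasing t by simp
      also have "\<dots> \<le> exp 1 * L2_norm (F 0)"
        by (intro mult_right_mono L2_norm_nonneg) simp
      finally show ?thesis using True by (simp add: l_def)
    next
      case False
      then have l: "0 < l" using \<nu> unfolding l_def by simp
      have "L2_norm (F t) \<le> exp 1 * L2_norm (F 0) * exp (- (t / (1 / (d * l))))"
      proof (rule exponential_decay_if_contraction[where N = "\<lambda>t. L2_norm (F t)", OF _ L2_norm_nonneg L2_norm_F_decreasing])
        fix s assume s: "0 < s" "s + 1 / (d * l) \<le> T"
        have "c * (l * (1 / (d * l))) = exp 2 * (8 + M)"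
          using l c M0 unfolding d_def by simp
        then show "L2_norm (F (s + 1 / (d * l))) \<le> exp (- 1) * L2_norm (F s)"
          using False d l s by (intro L2_norm_F_contraction[OF c c' M]) (auto simp: l_def)
      qed (use d l t in auto)
      then show ?thesis by (simp add: mult_ac)
    qed
    finally show "L2_norm (f t) \<le> exp 1 * L2_norm (fourier_coeff_x k f0) *
        exp (- (d * \<nu> powr (1/3) * (of_int \<bar>k\<bar>) powr (2/3) * t))"
      unfolding F_0 l_def by (simp add: mult.assoc)
  qed simp
qed

end
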